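(* Let $q_1,q_2<q^*$. Assume that $V_i\in C^2(0,\infty)$, $i=1,2$, and, with $R_i(y):=-\dfrac{yV_i''(y)}{V_i'(y)}$, $$\lim_{y\to0}R_i(y)=1-q_i,\qquad i=1,2.$$ Assume further that there are constants $\bar q\in(\max\{q_1,q_2,0\},1)$ and $K>0$ such that $$R_i(y)\,|V_i'(y)|=yV_i''(y)\le K\,y^{\bar q-1},\qquad y\ge1,\ i=1,2.$$ Then for every $x>0$, $$\lim_{t\to\infty}A(x,t)=\frac{\theta}{\sigma}\,(1-\min\{q_1,q_2\})\,x .$$
   Context: Market and problem. Let $r>0$ (riskless rate), $\delta>0$ (discount rate), $\mu>0$, $\sigma>0$ be constants, $\theta=\sigma^{-1}(\mu-r)\neq0$ (Sharpe ratio), and $W$ a standard Brownian motion. Wealth satisfies $dX_s=rX_s\,ds+X_s\pi_s\sigma(\theta\,ds+dW_s)-c_s\,ds$, where $\pi_s$ is the proportion of wealth in the risky asset and $c_s\ge0$ is the consumption rate. The agent maximizes $E\big[\int_0^T e^{-\delta s}U_2(c_s)\,ds+e^{-\delta T}U_1(X_T)\big]$ over $(\pi,c)$. The variable $t$ denotes the time horizon (time remaining to the terminal date), so the distant-horizon limit is $t\to\infty$. Standing assumptions on utilities, $i=1,2$: $U_i$ is continuously differentiable, strictly increasing and strictly concave on $(0,\infty)$, $U_i(0)=0$, $U_i'(0)=\infty$, $U_i'(\infty)=0$, and $U_i(x)\le C_0(1+x^p)$ for $x\ge0$ and some constants $C_0>0$, $0<p<1$. The dual functions are $V_i(y)=\sup_{x\ge0}\{U_i(x)-xy\}$,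 $y>0$. Constants: $\alpha=\frac12+\frac{r-\delta}{\theta^2}$, $a=\frac{\theta}{\sqrt2}$, $\beta=-a^2\alpha^2-\delta$. The threshold is $q^*=\alpha-\sqrt{\alpha^2+2\delta/\theta^2}<0$. Optimal strategies. For $y>0$, $t>0$ (with $\pi$ in the next formula the number $3.14\ldots$) let $$I_i(y,t)=\frac{e^{\beta t}}{2\sqrt{\pi}}\int_{-\infty}^\infty e^{-\frac{\eta^2}{4}-(\alpha-1)a\sqrt t\,\eta}\,\big|V_i'(ye^{a\sqrt t\,\eta})\big|\,d\eta,\qquad v_y(y,t)=-I_1(y,t)-\int_0^tI_2(y,\tau)\,d\tau .$$ For $x>0$, $t>0$, let $y=y(x,t)>0$ be the unique solution of $x=-v_y(y,t)$. The optimal amount of money in the risky asset at wealth $x$ with horizon $t$ is $$A(x,t)=\frac{\theta}{\sigma}\,y\,v_{yy}(y,t),\qquad y=y(x,t),$$ where $v_{yy}=\partial_y v_y$. *)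

theory Defs
  imports "HOL-Analysis.Analysis"
begin

definition strictly_concave_on :: "real set \<Rightarrow> (real \<Rightarrow> real) \<Rightarrow> bool" where
  "strictly_concave_on S f \<longleftrightarrow> convex S \<and>
     (\<forall>x\<in>S. \<forall>y\<in>S. \<forall>u. x \<noteq> y \<longrightarrow> 0 < u \<longrightarrow> u < 1 \<longrightarrow>
        (1 - u) * f x + u * f y < f ((1 - u) * x + u * y))"

text \<open>
  Only the restriction of \<open>U\<close> to \<open>[0, \<infinity>)\<close> matters. No continuity at \<open>0\<close> is imposed beyond
  the value \<open>U 0 = 0\<close>; \<open>U'(0) = \<infinity>\<close> is read as a right-hand limit of \<open>U'\<close>.
\<close>

definition utility :: "(real \<Rightarrow> real) \<Rightarrow> bool" where
  "utility U \<longleftrightarrow>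
     U C1_differentiable_on {0<..} \<and>
     strict_mono_on {0<..} U \<and>
     strictly_concave_on {0<..} U \<and>
     U 0 = 0 \<and>
     filterlim (deriv U) at_top (at_right 0) \<and>
     (deriv U \<longlongrightarrow> 0) at_top \<and>
     (\<exists>C0 p. 0 < C0 \<and> 0 < p \<and> p < 1 \<and> (\<forall>x\<ge>0. U x \<le> C0 * (1 + x powr p)))"

text \<open>
  The supremum is taken in the reals; for a \<open>utility\<close> and \<open>y > 0\<close> the growth bound makes the set
  bounded above. Values at \<open>y \<le> 0\<close> are meaningless and never used.
\<close>

definition dual :: "(real \<Rightarrow> real) \<Rightarrow> real \<Rightarrow> real" where
  "dual U y = (SUP x\<in>{0..}. U x - x * y)"

definition C2_on :: "real set \<Rightarrow> (real \<Rightarrow> real) \<Rightarrow> bool" where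
  "C2_on S f \<longleftrightarrow> f C1_differentiable_on S \<and> deriv f C1_differentiable_on S"

definition rel_risk :: "(real \<Rightarrow> real) \<Rightarrow> real \<Rightarrow> real" where
  "rel_risk V y = - (y * deriv (deriv V) y / deriv V y)"

definition sharpe :: "real \<Rightarrow> real \<Rightarrow> real \<Rightarrow> real" where
  "sharpe r \<mu> \<sigma> = (\<mu> - r) / \<sigma>"

definition alpha :: "real \<Rightarrow> real \<Rightarrow> real \<Rightarrow> real" where
  "alpha r \<delta> \<theta> = 1 / 2 + (r - \<delta>) / \<theta>\<^sup>2"

definition acoef :: "real \<Rightarrow> real" where
  "acoef \<theta> = \<theta> / sqrt 2"

definition beta :: "real \<Rightarrow> real \<Rightarrow> real \<Rightarrow> real" where
  "beta r \<delta> \<theta> = - (acoef \<theta>)\<^sup>2 * (alpha r \<delta> \<theta>)\<^sup>2 - \<delta>"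

definition qstar :: "real \<Rightarrow> real \<Rightarrow> real \<Rightarrow> real" where
  "qstar r \<delta> \<theta> = alpha r \<delta> \<theta> - sqrt ((alpha r \<delta> \<theta>)\<^sup>2 + 2 * \<delta> / \<theta>\<^sup>2)"

definition I_term :: "real \<Rightarrow> real \<Rightarrow> real \<Rightarrow> (real \<Rightarrow> real) \<Rightarrow> real \<Rightarrow> real \<Rightarrow> real" where
  "I_term r \<delta> \<theta> V y t =
     exp (beta r \<delta> \<theta> * t) / (2 * sqrt pi) *
     (LBINT \<eta>. exp (- (\<eta>\<^sup>2 / 4) - (alpha r \<delta> \<theta> - 1) * acoef \<theta> * sqrt t * \<eta>) *
        \<bar>deriv V (y * exp (acoef \<theta> * sqrt t * \<eta>))\<bar>)"

definition v_y ::
  "real \<Rightarrow> real \<Rightarrow> real \<Rightarrow> (real \<Rightarrow> real) \<Rightarrow> (real \<Rightarrow> real) \<Rightarrow> real \<Rightarrow> real \<Rightarrow> real" where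
  "v_y r \<delta> \<theta> U1 U2 y t =
     - I_term r \<delta> \<theta> (dual U1) y t - (LBINT \<tau>:{0..t}. I_term r \<delta> \<theta> (dual U2) y \<tau>)"

definition v_yy ::
  "real \<Rightarrow> real \<Rightarrow> real \<Rightarrow> (real \<Rightarrow> real) \<Rightarrow> (real \<Rightarrow> real) \<Rightarrow> real \<Rightarrow> real \<Rightarrow> real" where
  "v_yy r \<delta> \<theta> U1 U2 y t = deriv (\<lambda>z. v_y r \<delta> \<theta> U1 U2 z t) y"

definition y_of ::
  "real \<Rightarrow> real \<Rightarrow> real \<Rightarrow> (real \<Rightarrow> real) \<Rightarrow> (real \<Rightarrow> real) \<Rightarrow> real \<Rightarrow> real \<Rightarrow> real" where
  "y_of r \<delta> \<theta> U1 U2 x t = (THE y. 0 < y \<and> x = - v_y r \<delta> \<theta> U1 U2 y t)"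

text \<open>
  Optimal amount of money in the risky asset at wealth \<open>x\<close> and time to horizon \<open>t\<close>, for riskless
  rate \<open>r\<close>, discount rate \<open>\<delta>\<close>, drift \<open>\<mu>\<close>, volatility \<open>\<sigma>\<close>, terminal utility \<open>U1\<close> and
  consumption utility \<open>U2\<close>, given by its closed-form representation via the dual value function.
\<close>

definition opt_amount ::
  "real \<Rightarrow> real \<Rightarrow> real \<Rightarrow> real \<Rightarrow> (real \<Rightarrow> real) \<Rightarrow> (real \<Rightarrow> real) \<Rightarrow> real \<Rightarrow> real \<Rightarrow> real" where
  "opt_amount r \<delta> \<mu> \<sigma> U1 U2 x t =
     (let \<theta> = sharpe r \<mu> \<sigma>; y = y_of r \<delta> \<theta> U1 U2 x t
      in \<theta> / \<sigma> * y * v_yy r \<delta> \<theta> U1 U2 y t)"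

end

theory Submission
  imports Defs "HOL-Probability.Distributions"
begin

text \<open>
  Write \<open>f = -V'\<close> and \<open>g z = z V'' z\<close>. Both the terminal and the consumption term of \<open>-v_y\<close> are
  positive linear functionals of \<open>f\<close> of the form \<open>\<integral> w * f (y * u)\<close>; the same functional
  of \<open>g\<close> gives \<open>y * v_yy\<close>, and \<open>z powr (p - 1)\<close> is mapped to \<open>y powr (p - 1)\<close> times a factor growing like
  \<open>exp (L p * t)\<close> (or bounded, if \<open>L p < 0\<close>), where \<open>L\<close> is a convex quadratic with \<open>L 1 = -r\<close> that is
  positive left of \<open>q*\<close> and negative at \<open>qbar\<close>. With \<open>q = min q1 q2\<close> and \<open>y = y(x,t)\<close>, the difference
  \<open>y * v_yy - (1 - q) * x\<close> is the sum of the two functionals applied to \<open>g - (1 - q) * f\<close>. If \<open>q_i = q\<close>,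
  this integrand is at most \<open>\<epsilon> * f + C * z powr (qbar - 1)\<close>, which contributes \<open>\<epsilon> * x\<close> plus a term that
  vanishes since \<open>y \<rightarrow> \<infinity>\<close>. If \<open>q_i > q\<close>, it is dominated by \<open>z powr (p - 1)\<close> with \<open>q < p < q_i\<close>,
  and the lower bound on \<open>y\<close> forced by the dominant utility makes \<open>y powr (p - 1) * exp (L p * t)\<close> vanish.
\<close>

subsection \<open>Mixtures of rescaled functions\<close>

text \<open>Differentiation under the integral sign: by the mean value theorem \<open>B\<close>
  dominates all difference quotients on the convex set \<open>S\<close>, so dominated convergence
  applies along every sequence tending to \<open>y\<close>.\<close>

lemma has_real_derivative_lebesgue_integral:
  fixes F F' :: "real \<Rightarrow> 'a \<Rightarrow> real"
  assumes S: "open S" "convex S" "y \<in> S"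
    and int: "\<And>z. z \<in> S \<Longrightarrow> integrable M (F z)"
    and der: "\<And>z \<omega>. z \<in> S \<Longrightarrow> \<omega> \<in> space M \<Longrightarrow> ((\<lambda>z. F z \<omega>) has_real_derivative F' z \<omega>) (at z)"
    and meas: "F' y \<in> borel_measurable M"
    and bnd: "\<And>z \<omega>. z \<in> S \<Longrightarrow> \<omega> \<in> space M \<Longrightarrow> \<bar>F' z \<omega>\<bar> \<le> B \<omega>"
    and B: "integrable M B"
  shows "((\<lambda>z. \<integral>\<omega>. F z \<omega> \<partial>M) has_real_derivative (\<integral>\<omega>. F' y \<omega> \<partial>M)) (at y)"
proof -
  have lip: "\<bar>F z \<omega> - F y \<omega>\<bar> \<le> B \<omega> * \<bar>z - y\<bar>" if "z \<in> S" "\<omega> \<in> space M" for z \<omega>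
  proof -
    have "norm (F z \<omega> - F y \<omega>) \<le> B \<omega> * norm (z - y)"
      by (rule field_differentiable_bound[OF \<open>convex S\<close>, where f = "\<lambda>z. F z \<omega>" and f' = "\<lambda>z. F' z \<omega>"])
        (use that S bnd der in \<open>auto intro: has_field_derivative_at_within\<close>)
    then show ?thesis by simp
  qed
  have "((\<lambda>z. ((\<integral>\<omega>. F z \<omega> \<partial>M) - (\<integral>\<omega>. F y \<omega> \<partial>M)) / (z - y)) \<longlongrightarrow> (\<integral>\<omega>. F' y \<omega> \<partial>M)) (at y within S)"
    unfolding tendsto_at_iff_sequentially comp_def
  proof (intro allI impI)
    fix X :: "nat \<Rightarrow> real" assume X: "\<forall>i. X i \<in> S - {y}" "X \<longlonglongrightarrow> y"
    have lim: "(\<lambda>i. \<integral>\<omega>. (F (X i) \<omega> - F y \<omega>) / (X i - y) \<partial>M) \<longlonglongrightarrow> (\<integral>\<omega>. F' y \<omega> \<partial>M)"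
    proof (rule integral_dominated_convergence[where w = B])
      show "(\<lambda>\<omega>. (F (X i) \<omega> - F y \<omega>) / (X i - y)) \<in> borel_measurable M" for i
        using int[of "X i"] int[of y] X S by (intro borel_measurable_divide borel_measurable_diff) auto
      show "AE \<omega> in M. (\<lambda>i. (F (X i) \<omega> - F y \<omega>) / (X i - y)) \<longlonglongrightarrow> F' y \<omega>"
      proof (rule AE_I2)
        fix \<omega> assume "\<omega> \<in> space M"
        from der[OF S(3) this] have "((\<lambda>z. (F z \<omega> - F y \<omega>) / (z - y)) \<longlongrightarrow> F' y \<omega>) (at y)"
          by (simp add: has_field_derivative_iff)
        then show "(\<lambda>i. (F (X i) \<omega> - F y \<omega>) / (X i - y)) \<longlonglongrightarrow> F' y \<omega>"
          using X unfolding tendsto_at_iff_sequentially comp_def by auto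
      qed
      show "AE \<omega> in M. norm ((F (X i) \<omega> - F y \<omega>) / (X i - y)) \<le> B \<omega>" for i
        using X lip[of "X i"] by (auto intro!: AE_I2 simp: abs_divide divide_le_eq)
    qed (use meas B in auto)
    have "(\<lambda>i. \<integral>\<omega>. (F (X i) \<omega> - F y \<omega>) / (X i - y) \<partial>M) =
        (\<lambda>i. ((\<integral>\<omega>. F (X i) \<omega> \<partial>M) - (\<integral>\<omega>. F y \<omega> \<partial>M)) / (X i - y))"
    proof
      fix i
      have "integrable M (F (X i))" "integrable M (F y)" using X S int by auto
      then show "(\<integral>\<omega>. (F (X i) \<omega> - F y \<omega>) / (X i - y) \<partial>M) =
          ((\<integral>\<omega>. F (X i) \<omega> \<partial>M) - (\<integral>\<omega>. F y \<omega> \<partial>M)) / (X i - y)"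
        by (simp only: integral_divide_zero Bochner_Integration.integral_diff)
    qed
    then show "(\<lambda>i. ((\<integral>\<omega>. F (X i) \<omega> \<partial>M) - (\<integral>\<omega>. F y \<omega> \<partial>M)) / (X i - y)) \<longlonglongrightarrow> (\<integral>\<omega>. F' y \<omega> \<partial>M)"
      using lim by (rule subst[where P = "\<lambda>s. s \<longlonglongrightarrow> _"])
  qed
  then show ?thesis
    unfolding has_field_derivative_iff at_within_open[OF S(3,1)] .
qed

text \<open>Two exponents of arbitrary sign allow different growth at 0 and at infinity. All real
  moments of a lognormal law are finite, so such functions are integrable against the kernels
  below.\<close>

definition power_bounded :: "(real \<Rightarrow> real) \<Rightarrow> bool" where
  "power_bounded f \<longleftrightarrow> continuous_on {0<..} f \<and> (\<exists>C p m. \<forall>z>0. \<bar>f z\<bar> \<le> C * (z powr p + z powr m))"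

lemma power_boundedI:
  assumes "continuous_on {0<..} f" "\<And>z. 0 < z \<Longrightarrow> \<bar>f z\<bar> \<le> C * (z powr p + z powr m)"
  shows "power_bounded f"
  using assms unfolding power_bounded_def by blast

lemma power_bounded_powr: "power_bounded (\<lambda>z. z powr p)"
  by (rule power_boundedI[of _ 1 p p]) (auto intro!: continuous_intros)

text \<open>Common abstraction of the terminal term (a Gaussian integral over \<eta>) and of the
  consumption term (an integral over time and \<eta>), so that bounds and derivatives are proved
  once for both.\<close>

locale scale_mixture =
  fixes M :: "'a measure" and w u :: "'a \<Rightarrow> real"
  assumes w_nonneg: "\<And>\<omega>. 0 \<le> w \<omega>" and u_pos: "\<And>\<omega>. 0 < u \<omega>"
    and u_measurable [measurable]: "u \<in> borel_measurable M"
    and moment_integrable: "\<And>p. integrable M (\<lambda>\<omega>. w \<omega> * u \<omega> powr p)"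
begin

definition mix :: "(real \<Rightarrow> real) \<Rightarrow> real \<Rightarrow> real" where
  "mix f y = (\<integral>\<omega>. w \<omega> * f (y * u \<omega>) \<partial>M)"

definition moment :: "real \<Rightarrow> real" where
  "moment p = (\<integral>\<omega>. w \<omega> * u \<omega> powr p \<partial>M)"

text \<open>The integrand of the zeroth moment is \<open>w\<close> itself, because \<open>u\<close>
  is positive.\<close>

lemma w_measurable [measurable]: "w \<in> borel_measurable M"
  using moment_integrable[of 0] u_pos by (simp add: less_imp_neq[THEN not_sym] borel_measurable_integrable)

lemma moment_nonneg: "0 \<le> moment p"
  unfolding moment_def by (intro Bochner_Integration.integral_nonneg) (simp add: w_nonneg)

text \<open>Continuity is known on the positive half-line only, so \<open>f\<close> is cut off by an
  indicator; \<open>u > 0\<close> makes the cut-off invisible after composition.\<close>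

lemma scaled_measurable:
  fixes f :: "real \<Rightarrow> real"
  assumes "continuous_on {0<..} f" "0 < y"
  shows "(\<lambda>\<omega>. f (y * u \<omega>)) \<in> borel_measurable M"
proof -
  have "(\<lambda>z. indicator {0<..} z *\<^sub>R f z) \<in> borel_measurable borel"
    using assms by (intro borel_measurable_continuous_on_indicator) auto
  then have "(\<lambda>\<omega>. indicator {0<..} (y * u \<omega>) *\<^sub>R f (y * u \<omega>)) \<in> borel_measurable M"
    by measurable
  then show ?thesis using u_pos assms by simp
qed

lemma mix_integrable:
  assumes "power_bounded f" "0 < y"
  shows "integrable M (\<lambda>\<omega>. w \<omega> * f (y * u \<omega>))"
proof -
  obtain C p m where f: "continuous_on {0<..} f" and C: "\<And>z. 0 < z \<Longrightarrow> \<bar>f z\<bar> \<le> C * (z powr p + z powr m)"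
    using assms unfolding power_bounded_def by blast
  show ?thesis
  proof (rule Bochner_Integration.integrable_bound)
    show "integrable M (\<lambda>\<omega>. C * y powr p * (w \<omega> * u \<omega> powr p) + C * y powr m * (w \<omega> * u \<omega> powr m))"
      using moment_integrable by auto
    show "(\<lambda>\<omega>. w \<omega> * f (y * u \<omega>)) \<in> borel_measurable M"
      using scaled_measurable[OF f assms(2)] by measurable
    show "AE \<omega> in M. norm (w \<omega> * f (y * u \<omega>)) \<le>
        norm (C * y powr p * (w \<omega> * u \<omega> powr p) + C * y powr m * (w \<omega> * u \<omega> powr m))"
    proof (rule AE_I2)
      fix \<omega>
      have "\<bar>f (y * u \<omega>)\<bar> \<le> C * ((y * u \<omega>) powr p + (y * u \<omega>) powr m)"
        using C u_pos assms by simp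
      then have "w \<omega> * \<bar>f (y * u \<omega>)\<bar> \<le> w \<omega> * (C * ((y * u \<omega>) powr p + (y * u \<omega>) powr m))"
        by (intro mult_left_mono w_nonneg)
      also have "\<dots> = C * y powr p * (w \<omega> * u \<omega> powr p) + C * y powr m * (w \<omega> * u \<omega> powr m)"
        using assms(2) u_pos[of \<omega>] by (simp add: powr_mult algebra_simps)
      finally show "norm (w \<omega> * f (y * u \<omega>)) \<le>
        norm (C * y powr p * (w \<omega> * u \<omega> powr p) + C * y powr m * (w \<omega> * u \<omega> powr m))"
        using w_nonneg[of \<omega>] by (simp add: abs_mult)
    qed
  qed
qed

text \<open>Powers are eigenfunctions of \<open>mix\<close>. This turns pointwise power bounds into
  bounds that separate \<open>y\<close> from the moment, which carries the dependence on the
  horizon.\<close>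

lemma mix_powr:
  assumes "0 < y"
  shows "mix (\<lambda>z. z powr p) y = y powr p * moment p"
proof -
  have "w \<omega> * (y * u \<omega>) powr p = y powr p * (w \<omega> * u \<omega> powr p)" for \<omega>
    using assms u_pos[of \<omega>] by (simp add: powr_mult)
  then show ?thesis unfolding mix_def moment_def by (simp only: integral_mult_right_zero)
qed

lemma mix_nonneg:
  assumes "\<And>z. 0 < z \<Longrightarrow> 0 \<le> f z" "0 < y"
  shows "0 \<le> mix f y"
  unfolding mix_def by (intro Bochner_Integration.integral_nonneg) (simp add: w_nonneg assms u_pos)

text \<open>Positivity of the functional transfers a pointwise estimate to the mixtures. All
  long-horizon estimates come from this, with \<open>h\<close> either \<open>f\<close> itself or a
  power.\<close>

lemma mix_bound:
  assumes f: "power_bounded f" and h: "power_bounded h" and y: "0 < y"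
    and le: "\<And>z. 0 < z \<Longrightarrow> \<bar>f z\<bar> \<le> \<epsilon> * h z + C * z powr p"
  shows "\<bar>mix f y\<bar> \<le> \<epsilon> * mix h y + C * (y powr p * moment p)"
proof -
  note [simp] = mix_integrable[OF f y] mix_integrable[OF h y] mix_integrable[OF power_bounded_powr y]
  have "\<bar>mix f y\<bar> \<le> (\<integral>\<omega>. \<bar>w \<omega> * f (y * u \<omega>)\<bar> \<partial>M)"
    unfolding mix_def by (rule integral_abs_bound)
  also have "\<dots> \<le> (\<integral>\<omega>. \<epsilon> * (w \<omega> * h (y * u \<omega>)) + C * (w \<omega> * (y * u \<omega>) powr p) \<partial>M)"
  proof (rule integral_mono)
    fix \<omega>
    have "w \<omega> * \<bar>f (y * u \<omega>)\<bar> \<le> w \<omega> * (\<epsilon> * h (y * u \<omega>) + C * (y * u \<omega>) powr p)"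
      using u_pos y by (intro mult_left_mono w_nonneg le) simp
    then show "\<bar>w \<omega> * f (y * u \<omega>)\<bar> \<le> \<epsilon> * (w \<omega> * h (y * u \<omega>)) + C * (w \<omega> * (y * u \<omega>) powr p)"
      using w_nonneg[of \<omega>] by (simp add: abs_mult algebra_simps)
  qed auto
  also have "\<dots> = \<epsilon> * mix h y + C * mix (\<lambda>z. z powr p) y"
    unfolding mix_def by simp
  finally show ?thesis by (simp add: mix_powr y)
qed

lemma mix_diff_scaled:
  assumes "power_bounded f" "power_bounded g" "0 < y"
  shows "mix (\<lambda>z. g z - k * f z) y = mix g y - k * mix f y"
proof -
  note [simp] = mix_integrable[OF assms(1,3)] mix_integrable[OF assms(2,3)]
  have "mix (\<lambda>z. g z - k * f z) y = (\<integral>\<omega>. w \<omega> * g (y * u \<omega>) - k * (w \<omega> * f (y * u \<omega>)) \<partial>M)"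
    unfolding mix_def by (simp add: algebra_simps)
  then show ?thesis unfolding mix_def by simp
qed

text \<open>With \<open>g z = - z * f' z\<close>, the inner derivative \<open>u\<close> cancels
  against the \<open>u\<close> in the denominator, so the functional commutes with the operator
  \<open>- z * d/dz\<close>.\<close>

lemma has_real_derivative_mix:
  assumes f: "power_bounded f" and g: "power_bounded g" and y: "0 < y"
    and der: "\<And>z. 0 < z \<Longrightarrow> (f has_real_derivative - g z / z) (at z)"
  shows "(mix f has_real_derivative - mix g y / y) (at y)"
proof -
  obtain C p m where gc: "continuous_on {0<..} g" and C: "\<And>z. 0 < z \<Longrightarrow> \<bar>g z\<bar> \<le> C * (z powr p + z powr m)"
    using g unfolding power_bounded_def by blast
  \<comment> \<open>The sum of the two endpoint values bounds the monotone function
    \<open>z powr p\<close> on the interval, whatever the sign of \<open>p\<close>.\<close>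
  define N where "N p = (y/2) powr p + (2*y) powr p" for p
  have N: "z powr p \<le> N p" if "y / 2 < z" "z < 2 * y" for z p
  proof (cases "p \<ge> 0")
    case True
    then have "z powr p \<le> (2 * y) powr p" using that y by (intro powr_mono2) auto
    then show ?thesis unfolding N_def by (simp add: add_increasing)
  next
    case False
    then have "z powr p \<le> (y / 2) powr p" using that y by (intro powr_mono2') auto
    then show ?thesis unfolding N_def by (simp add: add_increasing2)
  qed
  have C0: "0 \<le> C" using C[of 1] by simp
  define B where "B \<omega> = C * N (p - 1) * (w \<omega> * u \<omega> powr p) + C * N (m - 1) * (w \<omega> * u \<omega> powr m)" for \<omega>
  have "((\<lambda>z. \<integral>\<omega>. w \<omega> * f (z * u \<omega>) \<partial>M) has_real_derivative (\<integral>\<omega>. - (w \<omega> * g (y * u \<omega>)) / y \<partial>M)) (at y)"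
  proof (rule has_real_derivative_lebesgue_integral[where S = "{y/2<..<2*y}" and B = B])
    fix z \<omega> assume z: "z \<in> {y/2<..<2*y}" and \<omega>: "\<omega> \<in> space M"
    then have z0: "0 < z" using y by auto
    have u: "0 < u \<omega>" by (rule u_pos)
    have "((\<lambda>z. f (z * u \<omega>)) has_real_derivative (- g (z * u \<omega>) / (z * u \<omega>)) * u \<omega>) (at z)"
      by (rule DERIV_chain2[OF der]) (use z0 u in \<open>auto intro!: derivative_eq_intros\<close>)
    then have "((\<lambda>z. w \<omega> * f (z * u \<omega>)) has_real_derivative w \<omega> * ((- g (z * u \<omega>) / (z * u \<omega>)) * u \<omega>)) (at z)"
      by (rule DERIV_cmult)
    then show "((\<lambda>z. w \<omega> * f (z * u \<omega>)) has_real_derivative - (w \<omega> * g (z * u \<omega>)) / z) (at z)"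
      using u by (simp add: field_simps)
    have "\<bar>g (z * u \<omega>)\<bar> / z \<le> C * ((z * u \<omega>) powr p + (z * u \<omega>) powr m) / z"
      using C[of "z * u \<omega>"] z0 u by (intro divide_right_mono) auto
    also have "\<dots> = C * (z powr (p - 1) * u \<omega> powr p + z powr (m - 1) * u \<omega> powr m)"
      using z0 u by (simp add: powr_mult powr_diff add_divide_distrib distrib_left)
    also have "\<dots> \<le> C * (N (p - 1) * u \<omega> powr p + N (m - 1) * u \<omega> powr m)"
      using z C0 N[of z "p - 1"] N[of z "m - 1"] by (intro mult_left_mono add_mono mult_right_mono) auto
    finally have "w \<omega> * (\<bar>g (z * u \<omega>)\<bar> / z) \<le> w \<omega> * (C * (N (p - 1) * u \<omega> powr p + N (m - 1) * u \<omega> powr m))"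
      by (intro mult_left_mono w_nonneg)
    then show "\<bar>- (w \<omega> * g (z * u \<omega>)) / z\<bar> \<le> B \<omega>"
      using w_nonneg[of \<omega>] z0 unfolding B_def by (simp add: abs_mult algebra_simps)
  next
    show "(\<lambda>\<omega>. - (w \<omega> * g (y * u \<omega>)) / y) \<in> borel_measurable M"
      using scaled_measurable[OF gc y] by measurable
    show "integrable M B" unfolding B_def using moment_integrable by auto
  qed (use y mix_integrable[OF f] in auto)
  moreover have "(\<integral>\<omega>. - (w \<omega> * g (y * u \<omega>)) / y \<partial>M) = - mix g y / y"
    unfolding mix_def by simp
  ultimately show ?thesis unfolding mix_def[abs_def] by simp
qed

end

subsection \<open>Functions with a limiting elasticity at zero\<close>

text \<open>The quotient by the power is continuous, hence bounded on the compact interval from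
  \<open>z0\<close> to 1, so the tail estimate extends down to any positive starting point.\<close>

lemma powr_dominated_from_tail:
  fixes h :: "real \<Rightarrow> real"
  assumes cont: "continuous_on {0<..} h" and tail: "\<And>z. 1 \<le> z \<Longrightarrow> h z \<le> K * z powr p" and z0: "0 < z0"
  shows "\<exists>C\<ge>0. \<forall>z\<ge>z0. h z \<le> C * z powr p"
proof -
  have "continuous_on {z0..1} (\<lambda>z. h z / z powr p)"
    using z0 by (intro continuous_intros continuous_on_subset[OF cont]) auto
  then have "bounded ((\<lambda>z. h z / z powr p) ` {z0..1})"
    by (intro compact_imp_bounded compact_continuous_image) auto
  then obtain B where "\<forall>x\<in>(\<lambda>z. h z / z powr p) ` {z0..1}. norm x \<le> B"
    unfolding bounded_iff by blast
  then have B: "\<bar>h z / z powr p\<bar> \<le> B" if "z \<in> {z0..1}" for z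
    using that unfolding real_norm_def by blast
  have "h z \<le> max 0 (max B K) * z powr p" if "z0 \<le> z" for z
  proof (cases "z \<le> 1")
    case True
    then have "h z / z powr p \<le> B" using B[of z] that by (simp only: abs_le_iff atLeastAtMost_iff)
    then have "h z / z powr p \<le> max 0 (max B K)" by linarith
    then show ?thesis using z0 that by (simp add: divide_le_eq)
  next
    case False
    then have "h z \<le> K * z powr p" using tail by simp
    also have "\<dots> \<le> max 0 (max B K) * z powr p" by (intro mult_right_mono) auto
    finally show ?thesis .
  qed
  then show ?thesis by (intro exI[of _ "max 0 (max B K)"]) auto
qed

text \<open>To be used with \<open>f = - V'\<close> and \<open>g z = z * V'' z\<close>, so that
  \<open>g / f\<close> is the relative risk \<open>R\<close> and \<open>m\<close> is
  \<open>qbar\<close>. The ratio is controlled at 0 only; at infinity there is just a power bound on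
  \<open>g\<close> and the decay of \<open>f\<close>.\<close>

locale elasticity_limit =
  fixes f g :: "real \<Rightarrow> real" and q m K :: real
  assumes deriv_f: "\<And>z. 0 < z \<Longrightarrow> (f has_real_derivative - g z / z) (at z)"
    and cont_g: "continuous_on {0<..} g"
    and f_nonneg: "\<And>z. 0 < z \<Longrightarrow> 0 \<le> f z" and g_nonneg: "\<And>z. 0 < z \<Longrightarrow> 0 \<le> g z"
    and ratio: "((\<lambda>z. g z / f z) \<longlongrightarrow> 1 - q) (at_right 0)"
    and g_tail: "\<And>z. 1 \<le> z \<Longrightarrow> g z \<le> K * z powr (m - 1)"
    and f_tendsto: "(f \<longlongrightarrow> 0) at_top"
    and q_less: "q < m" and m_less: "m < 1"
begin

lemma cont_f: "continuous_on {0<..} f"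
  by (rule DERIV_continuous_on[OF has_field_derivative_at_within[OF deriv_f]]) simp

text \<open>This is \<open>g_tail\<close> integrated: \<open>f z\<close> is the integral of
  \<open>g s / s\<close> from \<open>z\<close> to infinity, and
  \<open>K / (1 - m) * z powr (m - 1)\<close> is that of \<open>K * s powr (m - 2)\<close>. In
  differential form, the difference \<phi> is nondecreasing and tends to 0, so it is
  nonpositive.\<close>

lemma f_tail:
  assumes "1 \<le> z"
  shows "f z \<le> K / (1 - m) * z powr (m - 1)"
proof -
  define \<phi> where "\<phi> z = f z - K / (1 - m) * z powr (m - 1)" for z
  have mono: "\<phi> z \<le> \<phi> x" if "z \<le> x" for x
  proof (rule DERIV_nonneg_imp_nondecreasing[OF that])
    fix s assume s: "z \<le> s" "s \<le> x"
    then have s1: "1 \<le> s" using assms by simp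
    have "(\<phi> has_real_derivative (- g s / s - K / (1 - m) * ((m - 1) * s powr (m - 1 - 1)))) (at s)"
      unfolding \<phi>_def using s1 by (intro DERIV_diff deriv_f DERIV_cmult has_real_derivative_powr) auto
    moreover have "- g s / s - K / (1 - m) * ((m - 1) * s powr (m - 1 - 1)) = (K * s powr (m - 1) - g s) / s"
    proof -
      have "s powr (m - 1 - 1) = s powr (m - 1) / s" using powr_diff[of s "m - 1" 1] s1 by (simp only: powr_one)
      moreover have "K / (1 - m) * ((m - 1) * x) = - (K * x)" for x using m_less by (simp add: field_simps)
      ultimately show ?thesis by (simp add: diff_divide_distrib)
    qed
    moreover have "\<dots> \<ge> 0" using g_tail[OF s1] s1 by simp
    ultimately show "\<exists>y. (\<phi> has_real_derivative y) (at s) \<and> 0 \<le> y" by auto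
  qed
  have "((\<lambda>z. z powr (m - 1)) \<longlongrightarrow> 0) at_top"
    using m_less by (intro tendsto_neg_powr filterlim_ident) auto
  then have "(\<phi> \<longlongrightarrow> 0 - K / (1 - m) * 0) at_top"
    unfolding \<phi>_def by (intro tendsto_intros f_tendsto)
  then have "\<phi> z \<le> 0 - K / (1 - m) * 0"
    by (rule tendsto_lowerbound) (auto simp: eventually_at_top_linorder intro!: exI[of _ z] mono)
  then show ?thesis unfolding \<phi>_def by simp
qed

lemma tail_bound:
  assumes "0 < z0"
  shows "\<exists>C\<ge>0. \<forall>z\<ge>z0. f z \<le> C * z powr (m - 1) \<and> g z \<le> C * z powr (m - 1)"
proof -
  obtain C1 where C1: "C1 \<ge> 0" "\<forall>z\<ge>z0. f z \<le> C1 * z powr (m - 1)"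
    using powr_dominated_from_tail[OF cont_f f_tail assms] by blast
  obtain C2 where C2: "C2 \<ge> 0" "\<forall>z\<ge>z0. g z \<le> C2 * z powr (m - 1)"
    using powr_dominated_from_tail[OF cont_g g_tail assms] by blast
  have "C1 * z powr (m - 1) \<le> (C1 + C2) * z powr (m - 1)" "C2 * z powr (m - 1) \<le> (C1 + C2) * z powr (m - 1)" for z
    using C1 C2 by (auto intro!: mult_right_mono)
  then show ?thesis using C1 C2 by (intro exI[of _ "C1 + C2"]) (auto intro: order_trans)
qed

lemma near_zero:
  assumes "0 < \<epsilon>"
  shows "\<exists>z0>0. \<forall>z. 0 < z \<and> z \<le> z0 \<longrightarrow> 0 < f z \<and> 0 < g z \<and> \<bar>g z - (1 - q) * f z\<bar> \<le> \<epsilon> * f z"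
proof -
  \<comment> \<open>The cap \<open>1 - q\<close> keeps \<open>g z / f z\<close> positive. Since
    division by zero yields 0, a positive quotient also excludes \<open>f z = 0\<close>.\<close>
  define e where "e = min \<epsilon> (1 - q)"
  have e: "0 < e" "e \<le> \<epsilon>" "e \<le> 1 - q" using assms q_less m_less by (auto simp: e_def)
  have "eventually (\<lambda>z. dist (g z / f z) (1 - q) < e) (at_right 0)"
    using ratio e(1) by (rule tendstoD)
  then obtain b where b: "b > 0" "\<And>z. 0 < z \<Longrightarrow> z < b \<Longrightarrow> dist (g z / f z) (1 - q) < e"
    unfolding eventually_at_right_field by auto
  have "0 < f z \<and> 0 < g z \<and> \<bar>g z - (1 - q) * f z\<bar> \<le> \<epsilon> * f z" if z: "0 < z" "z \<le> b / 2" for z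
  proof -
    have d: "\<bar>g z / f z - (1 - q)\<bar> < e" using b z by (simp add: dist_real_def)
    then have pos: "0 < g z / f z" using e by linarith
    with f_nonneg[OF z(1)] g_nonneg[OF z(1)] have fg: "0 < f z" "0 < g z"
      by (auto simp: zero_less_divide_iff)
    have "\<bar>g z - (1 - q) * f z\<bar> = \<bar>g z / f z - (1 - q)\<bar> * f z"
    proof -
      have "g z - (1 - q) * f z = (g z / f z - (1 - q)) * f z" using fg by (simp add: left_diff_distrib)
      then show ?thesis using fg by (simp only: abs_mult abs_of_pos)
    qed
    also have "\<dots> \<le> \<epsilon> * f z" using d e fg by (intro mult_right_mono) auto
    finally show ?thesis using fg by blast
  qed
  then show ?thesis using b(1) by (intro exI[of _ "b / 2"]) auto
qed

text \<open>Near 0 the factor \<open>(1 - p) * f z - g z\<close> is nonnegative for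
  \<open>p < q\<close> and nonpositive for \<open>p > q\<close>; the resulting monotonicity of
  \<open>f z * z powr (1 - p)\<close> yields the upper and the lower power bound.\<close>

lemma deriv_scaled:
  assumes "0 < z"
  shows "((\<lambda>z. f z * z powr (1 - p)) has_real_derivative z powr (- p) * ((1 - p) * f z - g z)) (at z)"
proof -
  have "((\<lambda>z. f z * z powr (1 - p)) has_real_derivative
      - g z / z * z powr (1 - p) + (1 - p) * z powr (1 - p - 1) * f z) (at z)"
    using assms by (intro DERIV_mult deriv_f has_real_derivative_powr)
  moreover have "- g z / z * z powr (1 - p) + (1 - p) * z powr (1 - p - 1) * f z = z powr (- p) * ((1 - p) * f z - g z)"
  proof -
    have "z powr (1 - p) = z * z powr (- p)" using assms by (simp add: powr_diff powr_minus_divide)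
    then show ?thesis using assms by (simp add: algebra_simps)
  qed
  ultimately show ?thesis by simp
qed

text \<open>Near 0 the product \<open>f z * z powr (1 - p)\<close> is nondecreasing, hence at most
  its value at \<open>z0\<close>; beyond \<open>z0\<close> the tail bound takes over. The inequality
  \<open>p < q\<close> is strict because \<open>f\<close> may contain a slowly varying factor such
  as a logarithm.\<close>

lemma upper_bound:
  assumes "p < q"
  shows "\<exists>C\<ge>0. \<forall>z>0. f z \<le> C * (z powr (p - 1) + z powr (m - 1)) \<and> g z \<le> C * (z powr (p - 1) + z powr (m - 1))"
proof -
  have p1: "0 < 1 - p" using assms q_less m_less by simp
  obtain z0 where z0: "z0 > 0" and
    near: "\<And>z. 0 < z \<Longrightarrow> z \<le> z0 \<Longrightarrow> 0 < f z \<and> 0 < g z \<and> \<bar>g z - (1 - q) * f z\<bar> \<le> (q - p) * f z"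
    using near_zero[of "q - p"] assms by auto
  have gf: "g z \<le> (1 - p) * f z" if "0 < z" "z \<le> z0" for z
    using near[OF that] by (auto simp: algebra_simps)
  obtain C where C: "C \<ge> 0" "\<And>z. z \<ge> z0 \<Longrightarrow> f z \<le> C * z powr (m - 1) \<and> g z \<le> C * z powr (m - 1)"
    using tail_bound[OF z0] by blast
  define B where "B = f z0 * z0 powr (1 - p)"
  have B0: "0 \<le> B" unfolding B_def using f_nonneg z0 by simp
  have fB: "f z \<le> B * z powr (p - 1)" if z: "0 < z" "z \<le> z0" for z
  proof -
    have "f z * z powr (1 - p) \<le> B" unfolding B_def
    proof (rule DERIV_nonneg_imp_nondecreasing[OF z(2)])
      fix s assume s: "z \<le> s" "s \<le> z0"
      then have "s powr (- p) * ((1 - p) * f s - g s) \<ge> 0" using gf[of s] z by auto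
      then show "\<exists>y. ((\<lambda>z. f z * z powr (1 - p)) has_real_derivative y) (at s) \<and> 0 \<le> y"
        using deriv_scaled[of s p] s z by auto
    qed
    then show ?thesis using z by (simp add: powr_diff field_simps)
  qed
  define D where "D = C + B + (1 - p) * B"
  have D: "C \<le> D" "B \<le> D" "(1 - p) * B \<le> D" "0 \<le> D" using C(1) B0 p1 by (auto simp: D_def)
  have "f z \<le> D * (z powr (p - 1) + z powr (m - 1)) \<and> g z \<le> D * (z powr (p - 1) + z powr (m - 1))"
    if z: "0 < z" for z
  proof (cases "z \<le> z0")
    case True
    have "f z \<le> D * z powr (p - 1)"
      using fB[OF z True] D(2) by (smt (verit) mult_right_mono powr_ge_zero)
    moreover have "g z \<le> D * z powr (p - 1)"
    proof -
      have "g z \<le> (1 - p) * (B * z powr (p - 1))"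
        using gf[OF z True] fB[OF z True] p1 by (meson mult_left_mono less_imp_le order_trans)
      also have "\<dots> \<le> D * z powr (p - 1)" using D(3) by (simp add: mult_right_mono flip: mult.assoc)
      finally show ?thesis .
    qed
    moreover have "0 \<le> D * z powr (m - 1)" using D by simp
    ultimately show ?thesis by (simp add: distrib_left)
  next
    case False
    then have "f z \<le> C * z powr (m - 1)" "g z \<le> C * z powr (m - 1)" using C(2)[of z] by auto
    moreover have "C * z powr (m - 1) \<le> D * z powr (m - 1)" using D(1) by (simp add: mult_right_mono)
    moreover have "0 \<le> D * z powr (p - 1)" using D by simp
    ultimately show ?thesis by (simp add: distrib_left)
  qed
  then show ?thesis using D(4) by blast
qed

text \<open>Near 0 the product \<open>f z * z powr (1 - p)\<close> is nonincreasing, hence at least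
  its value at \<open>z0\<close>. Beyond \<open>z0\<close>, where \<open>f\<close> may vanish,
  \<open>p \<le> m\<close> lets the term in \<open>z powr (m - 1)\<close> absorb
  \<open>z powr (p - 1)\<close>.\<close>

lemma lower_bound:
  assumes "q < p" "p \<le> m"
  shows "\<exists>c>0. \<exists>C\<ge>0. \<forall>z>0. c * z powr (p - 1) \<le> f z + C * z powr (m - 1)"
proof -
  obtain z0 where z0: "z0 > 0" and
    near: "\<And>z. 0 < z \<Longrightarrow> z \<le> z0 \<Longrightarrow> 0 < f z \<and> 0 < g z \<and> \<bar>g z - (1 - q) * f z\<bar> \<le> (p - q) * f z"
    using near_zero[of "p - q"] assms by auto
  have gf: "g z \<ge> (1 - p) * f z" if "0 < z" "z \<le> z0" for z
    using near[OF that] by (auto simp: algebra_simps)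
  define c where "c = f z0 * z0 powr (1 - p)"
  have c: "0 < c" unfolding c_def using near[OF z0] z0 by simp
  define C where "C = c * z0 powr (p - m)"
  have C: "0 \<le> C" unfolding C_def using c by simp
  have "c * z powr (p - 1) \<le> f z + C * z powr (m - 1)" if z: "0 < z" for z
  proof (cases "z \<le> z0")
    case True
    have "c \<le> f z * z powr (1 - p)" unfolding c_def
    proof (rule DERIV_nonpos_imp_nonincreasing[OF True])
      fix s assume s: "z \<le> s" "s \<le> z0"
      then have "s powr (- p) * ((1 - p) * f s - g s) \<le> 0"
        using gf[of s] z by (auto intro!: mult_nonneg_nonpos)
      then show "\<exists>y. ((\<lambda>z. f z * z powr (1 - p)) has_real_derivative y) (at s) \<and> y \<le> 0"
        using deriv_scaled[of s p] s z by auto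
    qed
    then have "c * z powr (p - 1) \<le> f z" using z by (simp add: powr_diff field_simps)
    moreover have "0 \<le> C * z powr (m - 1)" using C by simp
    ultimately show ?thesis by linarith
  next
    case False
    have "z powr (p - m) \<le> z0 powr (p - m)" using False z0 assms by (intro powr_mono2') auto
    then have "c * (z powr (p - m) * z powr (m - 1)) \<le> C * z powr (m - 1)"
      unfolding C_def using c by (simp add: mult_right_mono)
    moreover have "z powr (p - m) * z powr (m - 1) = z powr (p - 1)" by (simp flip: powr_add)
    ultimately show ?thesis using f_nonneg[OF z] by simp
  qed
  then show ?thesis using c C by blast
qed

text \<open>The limit of the ratio gives the \<epsilon>-part near 0; everything away from 0 goes
  into the power \<open>m - 1\<close>, whose moments stay bounded in time.\<close>

lemma comparison:
  assumes "0 < \<epsilon>"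
  shows "\<exists>C\<ge>0. \<forall>z>0. \<bar>g z - (1 - q) * f z\<bar> \<le> \<epsilon> * f z + C * z powr (m - 1)"
proof -
  have q1: "0 < 1 - q" using q_less m_less by simp
  obtain z0 where z0: "z0 > 0" and
    near: "\<And>z. 0 < z \<Longrightarrow> z \<le> z0 \<Longrightarrow> 0 < f z \<and> 0 < g z \<and> \<bar>g z - (1 - q) * f z\<bar> \<le> \<epsilon> * f z"
    using near_zero[OF assms] by auto
  obtain C where C: "C \<ge> 0" "\<And>z. z \<ge> z0 \<Longrightarrow> f z \<le> C * z powr (m - 1) \<and> g z \<le> C * z powr (m - 1)"
    using tail_bound[OF z0] by blast
  define D where "D = C + (1 - q) * C"
  have D: "D \<ge> 0" unfolding D_def using C q1 by simp
  have "\<bar>g z - (1 - q) * f z\<bar> \<le> \<epsilon> * f z + D * z powr (m - 1)" if z: "0 < z" for z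
  proof (cases "z \<le> z0")
    case True
    have "0 \<le> D * z powr (m - 1)" using D by simp
    then show ?thesis using near[OF z True] by linarith
  next
    case False
    then have "f z \<le> C * z powr (m - 1)" "g z \<le> C * z powr (m - 1)" using C(2)[of z] by auto
    moreover from this q1 have "(1 - q) * f z \<le> (1 - q) * (C * z powr (m - 1))" by (intro mult_left_mono) auto
    moreover have "0 \<le> (1 - q) * f z" "0 \<le> g z" "0 \<le> \<epsilon> * f z"
      using f_nonneg[OF z] g_nonneg[OF z] q1 assms by auto
    ultimately show ?thesis unfolding D_def by (simp add: algebra_simps abs_if)
  qed
  then show ?thesis using D by blast
qed

lemma power_bounded_f: "power_bounded f" and power_bounded_g: "power_bounded g"
proof -
  \<comment> \<open>The exponent \<open>q - 1\<close> is an arbitrary choice below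
    \<open>q\<close>.\<close>
  obtain C where C: "\<And>z. z>0 \<Longrightarrow> f z \<le> C * (z powr (q - 1 - 1) + z powr (m - 1)) \<and>
      g z \<le> C * (z powr (q - 1 - 1) + z powr (m - 1))"
    using upper_bound[of "q - 1"] by auto
  show "power_bounded f" by (rule power_boundedI[OF cont_f]) (use C f_nonneg in auto)
  show "power_bounded g" by (rule power_boundedI[OF cont_g]) (use C g_nonneg in auto)
qed

lemma power_bounded_diff: "power_bounded (\<lambda>z. g z - k * f z)"
proof -
  obtain C where C: "C \<ge> 0" "\<And>z. z>0 \<Longrightarrow> f z \<le> C * (z powr (q - 1 - 1) + z powr (m - 1)) \<and>
      g z \<le> C * (z powr (q - 1 - 1) + z powr (m - 1))"
    using upper_bound[of "q - 1"] by auto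
  show ?thesis
  proof (rule power_boundedI)
    show "continuous_on {0<..} (\<lambda>z. g z - k * f z)"
      by (intro continuous_intros cont_f cont_g)
    fix z :: real assume z: "0 < z"
    define P where "P = z powr (q - 1 - 1) + z powr (m - 1)"
    have "\<bar>g z - k * f z\<bar> \<le> g z + \<bar>k\<bar> * f z"
      using f_nonneg[OF z] g_nonneg[OF z] abs_triangle_ineq4[of "g z" "k * f z"] by (simp add: abs_mult)
    also have "\<dots> \<le> C * P + \<bar>k\<bar> * (C * P)"
      using C(2)[OF z] by (intro add_mono mult_left_mono) (auto simp: P_def)
    finally show "\<bar>g z - k * f z\<bar> \<le> ((1 + \<bar>k\<bar>) * C) * (z powr (q - 1 - 1) + z powr (m - 1))"
      by (simp add: P_def algebra_simps)
  qed
qed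

end

text \<open>Bounding \<open>-V'\<close> at infinity uses only that \<open>V\<close> is convex, decreasing and nonnegative.\<close>

lemma dual_elasticity_limit:
  assumes U: "utility U" and C2: "C2_on {0<..} (dual U)"
    and lim: "(rel_risk (dual U) \<longlongrightarrow> 1 - q) (at_right 0)"
    and tail: "\<And>y. 1 \<le> y \<Longrightarrow> y * deriv (deriv (dual U)) y \<le> K * y powr (m - 1)"
    and "q < m" "m < 1"
  shows "elasticity_limit (\<lambda>z. - deriv (dual U) z) (\<lambda>z. z * deriv (deriv (dual U)) z) q m K"
proof -
  let ?V = "dual U"
  have U0: "U 0 = 0" using U unfolding utility_def by simp
  obtain C0 p where p: "0 < C0" "0 < p" "p < 1" and UC: "\<And>x. x \<ge> 0 \<Longrightarrow> U x \<le> C0 * (1 + x powr p)"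
    using U unfolding utility_def by blast
  have bdd: "bdd_above ((\<lambda>x. U x - x * y) ` {0..})" if y: "0 < y" for y
  proof -
    \<comment> \<open>The growth bound is sublinear: past some point \<open>C0 * x powr p\<close>
      stays below \<open>y * x\<close>, and what remains of \<open>U x - x * y\<close> is at most
      \<open>C0\<close>.\<close>
    have "((\<lambda>x. C0 * (x powr (p - 1)) - y) \<longlongrightarrow> C0 * 0 - y) at_top"
      using p by (intro tendsto_intros tendsto_neg_powr filterlim_ident) auto
    then have "eventually (\<lambda>x. C0 * (x powr (p - 1)) - y < 0) at_top"
      using y by (intro order_tendstoD(2)) auto
    then obtain N where N: "\<And>x. x \<ge> N \<Longrightarrow> C0 * (x powr (p - 1)) < y"
      unfolding eventually_at_top_linorder by auto
    define N' where "N' = max N 1"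
    have "U x - x * y \<le> C0 * (1 + N' powr p)" if x: "0 \<le> x" for x
    proof (cases "x \<le> N'")
      case True
      have "U x \<le> C0 * (1 + x powr p)" using UC x by simp
      also have "\<dots> \<le> C0 * (1 + N' powr p)" using p True x by (intro mult_left_mono add_left_mono powr_mono2) auto
      finally show ?thesis using x y by (smt (verit) mult_nonneg_nonneg)
    next
      case False
      then have xN: "x \<ge> N" "x > 0" unfolding N'_def by auto
      have "C0 * x powr p = C0 * x powr (p - 1) * x" using xN by (simp add: powr_diff)
      also have "\<dots> \<le> y * x" using N[OF xN(1)] xN by (intro mult_right_mono) auto
      finally have "C0 * x powr p \<le> y * x" .
      moreover have "0 \<le> C0 * N' powr p" using p by simp
      ultimately show ?thesis using UC[OF x] by (simp add: algebra_simps)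
    qed
    then show ?thesis by (intro bdd_aboveI[of _ "C0 * (1 + N' powr p)"]) auto
  qed
  have upper: "U x - x * y \<le> ?V y" if "0 < y" "0 \<le> x" for x y
    unfolding dual_def using that by (intro cSUP_upper bdd) auto
  have V_nonneg: "0 \<le> ?V y" if "0 < y" for y
    using upper[of y 0] that U0 by simp
  have V_dec: "?V z \<le> ?V y" if "0 < y" "y \<le> z" for y z
    unfolding dual_def[of U z]
  proof (rule cSUP_least)
    fix x :: real assume "x \<in> {0..}"
    then have "U x - x * z \<le> U x - x * y" using that by (simp add: mult_left_mono)
    also have "\<dots> \<le> ?V y" using upper that \<open>x \<in> {0..}\<close> by simp
    finally show "U x - x * z \<le> ?V y" .
  qed auto
  have V_convex: "convex_on {0<..} ?V"
  proof (rule convex_onI)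
    fix t x y :: real assume t: "0 < t" "t < 1" and xy: "x \<in> {0<..}" "y \<in> {0<..}"
    show "?V ((1 - t) *\<^sub>R x + t *\<^sub>R y) \<le> (1 - t) * ?V x + t * ?V y"
      unfolding dual_def[of U "(1 - t) *\<^sub>R x + t *\<^sub>R y"]
    proof (rule cSUP_least)
      fix s :: real assume s: "s \<in> {0..}"
      have "U s - s * ((1 - t) *\<^sub>R x + t *\<^sub>R y) = (1 - t) * (U s - s * x) + t * (U s - s * y)"
        by (simp add: algebra_simps)
      also have "\<dots> \<le> (1 - t) * ?V x + t * ?V y"
        using t s xy upper by (intro add_mono mult_left_mono) auto
      finally show "U s - s * ((1 - t) *\<^sub>R x + t *\<^sub>R y) \<le> (1 - t) * ?V x + t * ?V y" .
    qed auto
  qed (simp add: convex_real_interval)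
  have C1: "?V C1_differentiable_on {0<..}" "deriv ?V C1_differentiable_on {0<..}"
    using C2 unfolding C2_on_def by auto
  \<comment> \<open>\<open>C1_differentiable_on\<close> is phrased with
    \<open>vector_derivative\<close>, which agrees with \<open>deriv\<close> at every point of the
    open half-line.\<close>
  have der: "(h has_real_derivative deriv h z) (at z)" and cont: "continuous_on {0<..} (deriv h)"
    if h: "h C1_differentiable_on {0<..}" and z: "0 < z" for h :: "real \<Rightarrow> real" and z
  proof -
    have D: "(h has_real_derivative vector_derivative h (at y)) (at y)" if "0 < y" for y
      using h that unfolding C1_differentiable_on_eq
      by (auto simp: has_real_derivative_iff_has_vector_derivative simp flip: vector_derivative_works)
    then have eq: "deriv h y = vector_derivative h (at y)" if "0 < y" for y
      using that DERIV_imp_deriv by blast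
    show "(h has_real_derivative deriv h z) (at z)" using D[OF z] eq[OF z] by simp
    have "continuous_on {0<..} (\<lambda>y. vector_derivative h (at y))"
      using h unfolding C1_differentiable_on_eq by simp
    then show "continuous_on {0<..} (deriv h)"
      by (rule continuous_on_eq) (simp add: eq)
  qed
  have tangent: "?V x - ?V c \<ge> deriv ?V c * (x - c)" if "0 < c" "0 < x" for x c
    by (rule convex_on_imp_above_tangent[OF V_convex _ _ _ has_field_derivative_at_within[OF der[OF C1(1) that(1)]]])
      (use that in \<open>auto simp: interior_open\<close>)
  have V'_nonpos: "deriv ?V z \<le> 0" if z: "0 < z" for z
    using tangent[of z "z + 1"] V_dec[of z "z + 1"] z by simp
  have V'_mono: "mono_on {0<..} (deriv ?V)"
  proof (rule mono_onI)
    fix x y :: real assume xy: "x \<in> {0<..}" "y \<in> {0<..}" "x \<le> y"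
    \<comment> \<open>Sum of the tangent inequalities at \<open>x\<close> and at
      \<open>y\<close>.\<close>
    have "(deriv ?V y - deriv ?V x) * (y - x) \<ge> 0"
      using tangent[of x y] tangent[of y x] xy by (simp add: algebra_simps)
    then show "deriv ?V x \<le> deriv ?V y" using xy(3)
      by (cases "x = y") (auto simp: zero_le_mult_iff)
  qed
  show ?thesis
  proof
    fix z :: real assume z: "0 < z"
    show "((\<lambda>z. - deriv ?V z) has_real_derivative - (z * deriv (deriv ?V) z) / z) (at z)"
      using der[OF C1(2) z] z by (auto intro!: derivative_eq_intros)
    show "0 \<le> - deriv ?V z" using V'_nonpos[OF z] by simp
    have "0 \<le> deriv (deriv ?V) z"
      by (rule mono_on_imp_deriv_nonneg[OF V'_mono der[OF C1(2) z]]) (use z in \<open>simp add: interior_open\<close>)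
    then show "0 \<le> z * deriv (deriv ?V) z" using z by simp
  next
    show "continuous_on {0<..} (\<lambda>z. z * deriv (deriv ?V) z)"
      using cont[OF C1(2), of 1] by (intro continuous_intros) auto
    have "rel_risk ?V = (\<lambda>z. z * deriv (deriv ?V) z / - deriv ?V z)"
      by (simp add: rel_risk_def fun_eq_iff)
    then show "((\<lambda>z. z * deriv (deriv ?V) z / - deriv ?V z) \<longlongrightarrow> 1 - q) (at_right 0)"
      using lim by simp
    show "((\<lambda>z. - deriv ?V z) \<longlongrightarrow> 0) at_top"
    proof (rule tendsto_sandwich)
      show "eventually (\<lambda>z. 0 \<le> - deriv ?V z) at_top"
        using eventually_gt_at_top[of 0] by eventually_elim (simp add: V'_nonpos)
      \<comment> \<open>The tangent at \<open>z\<close>, evaluated at 1, lies below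
        \<open>?V 1\<close>; since \<open>?V z\<close> is nonnegative this bounds
        \<open>- deriv ?V z * (z - 1)\<close> by \<open>?V 1\<close>, and
        \<open>z / 2 \<le> z - 1\<close> for \<open>z > 2\<close>.\<close>
      show "eventually (\<lambda>z. - deriv ?V z \<le> 2 * ?V 1 / z) at_top"
        using eventually_gt_at_top[of 2]
      proof eventually_elim
        case (elim z)
        have "- deriv ?V z * (z / 2) \<le> - deriv ?V z * (z - 1)"
          using V'_nonpos[of z] elim by (intro mult_left_mono) auto
        also have "\<dots> \<le> ?V 1"
          using tangent[of z 1] V_nonneg[of z] elim by (simp add: algebra_simps)
        finally show ?case using elim by (simp add: pos_le_divide_eq)
      qed
      show "((\<lambda>z. 2 * ?V 1 / z) \<longlongrightarrow> 0) at_top"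
        by (intro tendsto_divide_0[OF tendsto_const] filterlim_at_top_imp_at_infinity filterlim_ident)
    qed auto
  qed (use tail assms in auto)
qed

subsection \<open>The lognormal kernel\<close>

text \<open>Completing the square gives a multiple of the normal density with mean
  \<open>2 * s\<close> and variance 2.\<close>

lemma gaussian_exp_linear:
  fixes s :: real
  shows "integrable lborel (\<lambda>\<eta>. exp (- (\<eta>\<^sup>2 / 4) + s * \<eta>))" (is ?int)
    and "(\<integral>\<eta>. exp (- (\<eta>\<^sup>2 / 4) + s * \<eta>) \<partial>lborel) = 2 * sqrt pi * exp (s\<^sup>2)" (is ?val)
proof -
  have "exp (- (\<eta>\<^sup>2 / 4) + s * \<eta>) = 2 * sqrt pi * exp (s\<^sup>2) * normal_density (2 * s) (sqrt 2) \<eta>" for \<eta> :: real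
  proof -
    have "sqrt (2 * pi * (sqrt 2)\<^sup>2) = 2 * sqrt pi"
      by (simp add: real_sqrt_mult)
    moreover have "- (\<eta> - 2 * s)\<^sup>2 / (2 * (sqrt 2)\<^sup>2) = - (\<eta>\<^sup>2 / 4) + s * \<eta> - s\<^sup>2"
      by (simp add: power2_eq_square field_simps)
    ultimately show ?thesis
      by (simp add: normal_density_def flip: exp_add)
  qed
  then have eq: "(\<lambda>\<eta>. exp (- (\<eta>\<^sup>2 / 4) + s * \<eta>)) =
      (\<lambda>\<eta>. 2 * sqrt pi * exp (s\<^sup>2) * normal_density (2 * s) (sqrt 2) \<eta>)" by blast
  show ?int unfolding eq by simp
  show ?val unfolding eq by simp
qed

text \<open>The kernel of \<open>I_term\<close>, with \<kappa> in the role of \<alpha> - 1.\<close>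

locale lognormal_kernel =
  fixes a \<kappa> \<beta> :: real
begin

definition weight :: "real \<Rightarrow> real \<Rightarrow> real" where
  "weight t \<eta> = exp (\<beta> * t) / (2 * sqrt pi) * exp (- (\<eta>\<^sup>2 / 4) - \<kappa> * a * sqrt t * \<eta>)"

definition scaling :: "real \<Rightarrow> real \<Rightarrow> real" where
  "scaling t \<eta> = exp (a * sqrt t * \<eta>)"

text \<open>Exponential growth rate in \<open>t\<close> of the moment of order \<open>p\<close>,
  read off from the Gaussian integral; \<open>rate (p - 1)\<close> will be the quadratic
  \<open>L p\<close>.\<close>

definition rate :: "real \<Rightarrow> real" where
  "rate p = \<beta> + a\<^sup>2 * (p - \<kappa>)\<^sup>2"

lemma weight_pos: "0 < weight t \<eta>"
  by (simp add: weight_def)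

lemma weight_scaling:
  "weight t \<eta> * scaling t \<eta> powr p =
    exp (\<beta> * t) / (2 * sqrt pi) * exp (- (\<eta>\<^sup>2 / 4) + ((p - \<kappa>) * a * sqrt t) * \<eta>)"
proof -
  have "scaling t \<eta> powr p = exp (p * (a * sqrt t * \<eta>))"
    by (simp add: scaling_def powr_def)
  then have "weight t \<eta> * scaling t \<eta> powr p = exp (\<beta> * t) / (2 * sqrt pi) *
      exp ((- (\<eta>\<^sup>2 / 4) - \<kappa> * a * sqrt t * \<eta>) + p * (a * sqrt t * \<eta>))"
    unfolding weight_def by (simp add: exp_add)
  then show ?thesis by (simp add: algebra_simps)
qed

lemma weight_scaling_integrable: "integrable lborel (\<lambda>\<eta>. weight t \<eta> * scaling t \<eta> powr p)"
  unfolding weight_scaling by (intro integrable_mult_right gaussian_exp_linear)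

lemma weight_scaling_integral:
  assumes "0 \<le> t"
  shows "(\<integral>\<eta>. weight t \<eta> * scaling t \<eta> powr p \<partial>lborel) = exp (rate p * t)"
proof -
  have "((p - \<kappa>) * a * sqrt t)\<^sup>2 = a\<^sup>2 * (p - \<kappa>)\<^sup>2 * t"
    using assms by (simp add: power_mult_distrib)
  then have "(\<integral>\<eta>. weight t \<eta> * scaling t \<eta> powr p \<partial>lborel) = exp (\<beta> * t) * exp (a\<^sup>2 * (p - \<kappa>)\<^sup>2 * t)"
    unfolding weight_scaling integral_mult_right_zero gaussian_exp_linear by simp
  then show ?thesis by (simp add: rate_def distrib_right flip: exp_add)
qed

sublocale spot: scale_mixture lborel "weight t" "scaling t" for t
proof
  show "scaling t \<in> borel_measurable lborel" by (simp add: scaling_def[abs_def])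
qed (simp_all add: weight_pos less_imp_le weight_scaling_integrable, simp add: scaling_def)

lemma spot_moment: "0 \<le> t \<Longrightarrow> spot.moment t p = exp (rate p * t)"
  unfolding spot.moment_def by (rule weight_scaling_integral)

text \<open>The time integral of the consumption term is absorbed into the measure: on pairs of time
  and \<eta> the horizon enters only through the indicator.\<close>

definition run_weight :: "real \<Rightarrow> real \<times> real \<Rightarrow> real" where
  "run_weight t = (\<lambda>(\<tau>, \<eta>). indicator {0..t} \<tau> * weight \<tau> \<eta>)"

definition run_scaling :: "real \<times> real \<Rightarrow> real" where
  "run_scaling = (\<lambda>(\<tau>, \<eta>). scaling \<tau> \<eta>)"

lemma run_measurable:
  "run_weight t \<in> borel_measurable (lborel \<Otimes>\<^sub>M lborel)" "run_scaling \<in> borel_measurable (lborel \<Otimes>\<^sub>M lborel)"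
  unfolding run_weight_def run_scaling_def weight_def scaling_def by measurable

lemma run_inner_integral:
  "(\<integral>\<eta>. run_weight t (\<tau>, \<eta>) * run_scaling (\<tau>, \<eta>) powr p \<partial>lborel) = indicator {0..t} \<tau> * exp (rate p * \<tau>)"
proof (cases "\<tau> \<in> {0..t}")
  case True
  then show ?thesis by (simp add: run_weight_def run_scaling_def weight_scaling_integral)
qed (simp add: run_weight_def)

lemma exp_set_integrable: "integrable lborel (\<lambda>\<tau>. indicator {0..t} \<tau> * exp (c * \<tau>) :: real)"
proof -
  have "set_integrable lborel {0..t} (\<lambda>\<tau>. exp (c * \<tau>))"
    by (intro borel_integrable_atLeastAtMost' continuous_intros)
  then show ?thesis by (simp add: set_integrable_def)
qed

sublocale run: scale_mixture "lborel \<Otimes>\<^sub>M lborel" "run_weight t" run_scaling for t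
proof
  show "integrable (lborel \<Otimes>\<^sub>M lborel) (\<lambda>\<omega>. run_weight t \<omega> * run_scaling \<omega> powr p)" for p
  \<comment> \<open>The integrand is nonnegative, so absolute integrability reduces to the inner
    Gaussian integral, an exponential in time on a compact interval.\<close>
  proof (rule lborel_pair.Fubini_integrable)
    show "(\<lambda>\<omega>. run_weight t \<omega> * run_scaling \<omega> powr p) \<in> borel_measurable (lborel \<Otimes>\<^sub>M lborel)"
      using run_measurable by measurable
    have "norm (run_weight t (\<tau>, \<eta>) * run_scaling (\<tau>, \<eta>) powr p) =
        run_weight t (\<tau>, \<eta>) * run_scaling (\<tau>, \<eta>) powr p" for \<tau> \<eta>
      by (simp add: run_weight_def weight_pos less_imp_le)
    then show "integrable lborel (\<lambda>\<tau>. \<integral>\<eta>. norm (run_weight t (\<tau>, \<eta>) * run_scaling (\<tau>, \<eta>) powr p) \<partial>lborel)"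
      by (simp only: run_inner_integral exp_set_integrable)
    have "integrable lborel (\<lambda>\<eta>. run_weight t (\<tau>, \<eta>) * run_scaling (\<tau>, \<eta>) powr p)" for \<tau>
      using integrable_mult_right[OF weight_scaling_integrable, of "indicator {0..t} \<tau>" \<tau> p]
      by (simp add: run_weight_def run_scaling_def mult.assoc)
    then show "AE \<tau> in lborel. integrable lborel (\<lambda>\<eta>. run_weight t (\<tau>, \<eta>) * run_scaling (\<tau>, \<eta>) powr p)"
      by simp
  qed
qed (use run_measurable in \<open>auto simp: run_weight_def run_scaling_def scaling_def weight_pos less_imp_le\<close>)

lemma run_moment:
  assumes "0 \<le> t" "rate p \<noteq> 0"
  shows "run.moment t p = (exp (rate p * t) - 1) / rate p"
proof -
  have "run.moment t p = (\<integral>\<tau>. (\<integral>\<eta>. run_weight t (\<tau>, \<eta>) * run_scaling (\<tau>, \<eta>) powr p \<partial>lborel) \<partial>lborel)"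
    unfolding run.moment_def by (rule lborel_pair.integral_fst'[symmetric]) (rule run.moment_integrable)
  also have "\<dots> = (\<integral>\<tau>. exp (rate p * \<tau>) * indicator {0..t} \<tau> \<partial>lborel)"
    by (simp only: run_inner_integral mult.commute[of "indicator _ _"])
  also have "\<dots> = exp (rate p * t) / rate p - exp (rate p * 0) / rate p"
    by (rule integral_FTC_Icc_real) (use assms in \<open>auto intro!: derivative_eq_intros continuous_intros\<close>)
  finally show ?thesis by (simp add: diff_divide_distrib)
qed

text \<open>Fubini restores the iterated form in which \<open>v_y\<close> integrates
  \<open>I_term\<close> over time.\<close>

lemma run_mix:
  assumes "power_bounded f" "0 < y"
  shows "run.mix t f y = (\<integral>\<tau>. indicator {0..t} \<tau> * spot.mix \<tau> f y \<partial>lborel)"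
proof -
  have "run.mix t f y = (\<integral>\<tau>. (\<integral>\<eta>. run_weight t (\<tau>, \<eta>) * f (y * run_scaling (\<tau>, \<eta>)) \<partial>lborel) \<partial>lborel)"
    unfolding run.mix_def by (rule lborel_pair.integral_fst'[symmetric]) (rule run.mix_integrable[OF assms])
  then show ?thesis
    unfolding spot.mix_def by (simp add: run_weight_def run_scaling_def mult.assoc)
qed

text \<open>A vanishing integral of a nonnegative integrand would make it zero almost everywhere,
  but it is positive on an interval of length one. This later makes the dual wealth strictly
  decreasing.\<close>

lemma spot_mix_pos:
  assumes f: "power_bounded f" and nonneg: "\<And>z. 0 < z \<Longrightarrow> 0 \<le> f z" and z0: "0 < z0"
    and pos: "\<And>z. 0 < z \<Longrightarrow> z \<le> z0 \<Longrightarrow> 0 < f z" and "a \<noteq> 0" "0 < t" and y: "0 < y"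
  shows "0 < spot.mix t f y"
proof (rule ccontr)
  assume "\<not> ?thesis"
  then have "spot.mix t f y = 0" using spot.mix_nonneg[of f y t] nonneg y by force
  moreover have "AE \<eta> in lborel. 0 \<le> weight t \<eta> * f (y * scaling t \<eta>)"
    using nonneg y spot.u_pos weight_pos by (intro AE_I2 mult_nonneg_nonneg) (auto intro: less_imp_le)
  ultimately have "AE \<eta> in lborel. weight t \<eta> * f (y * scaling t \<eta>) = 0"
    using integral_nonneg_eq_0_iff_AE[OF spot.mix_integrable[OF f y, of t]] unfolding spot.mix_def by blast
  moreover define b where "b = a * sqrt t"
  \<comment> \<open>\<open>\<eta>0\<close> solves \<open>y * exp (b * \<eta>) = z0\<close>; the
    interval \<open>J\<close> lies on the side, given by the sign of \<open>b\<close>, where the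
    argument of \<open>f\<close> stays at most \<open>z0\<close>.\<close>
  moreover define \<eta>0 where "\<eta>0 = ln (z0 / y) / b"
  define J where "J = (if b > 0 then {\<eta>0 - 1..\<eta>0} else {\<eta>0..\<eta>0 + 1})"
  have b: "b \<noteq> 0" using \<open>a \<noteq> 0\<close> \<open>0 < t\<close> by (simp add: b_def)
  have "weight t \<eta> * f (y * scaling t \<eta>) \<noteq> 0" if "\<eta> \<in> J" for \<eta>
  proof -
    have "b * \<eta> \<le> b * \<eta>0" using that b by (auto simp: J_def split: if_splits)
    also have "\<dots> = ln (z0 / y)" using b by (simp add: \<eta>0_def)
    finally have "exp (b * \<eta>) \<le> z0 / y" using z0 y by (simp add: ln_ge_iff)
    then have "y * scaling t \<eta> \<le> z0" using y by (simp add: scaling_def b_def field_simps)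
    then show ?thesis using pos[of "y * scaling t \<eta>"] y spot.u_pos[of t \<eta>] weight_pos[of t \<eta>] by simp
  qed
  ultimately have "AE \<eta> in lborel. \<eta> \<notin> J" by auto
  then have "emeasure lborel J = 0"
    by (subst (asm) AE_iff_measurable[OF _ refl]) (auto simp: J_def)
  then show False by (auto simp: J_def split: if_splits)
qed

end

subsection \<open>Long-horizon asymptotics\<close>

text \<open>The moment asymptotics shared by the terminal and the running kernel. The restriction
  \<open>t \<ge> 1\<close> matters for the running kernel, whose moments vanish as \<open>t\<close>
  tends to 0.\<close>

locale horizon_family =
  fixes M :: "'a measure" and w u :: "real \<Rightarrow> 'a \<Rightarrow> real" and L :: "real \<Rightarrow> real"
  assumes scale_mixture: "\<And>t. scale_mixture M (w t) (u t)"
    and moment_decay: "\<And>p. L p < 0 \<Longrightarrow> \<exists>D. \<forall>t\<ge>1. scale_mixture.moment M (w t) (u t) (p - 1) \<le> D"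
    and moment_upper: "\<And>p. 0 < L p \<Longrightarrow>
      \<exists>D. \<forall>t\<ge>1. scale_mixture.moment M (w t) (u t) (p - 1) \<le> D * exp (L p * t)"
    and moment_lower: "\<And>p. 0 < L p \<Longrightarrow>
      \<exists>d>0. \<forall>t\<ge>1. d * exp (L p * t) \<le> scale_mixture.moment M (w t) (u t) (p - 1)"
begin

sublocale mx: scale_mixture M "w t" "u t" for t
  by (rule scale_mixture)

text \<open>\<open>lower_bound\<close> integrated against the kernel: \<open>mix_bound\<close> is
  applied to the power \<open>p - 1\<close>, which is dominated by \<open>f\<close> and the power
  \<open>m - 1\<close>.\<close>

lemma mix_lower_growth:
  assumes "elasticity_limit f g q m K" and p: "q < p" "p \<le> m" "0 < L p" and m: "L m < 0"
  shows "\<exists>c>0. \<exists>C\<ge>0. \<forall>t\<ge>1. \<forall>y>0. c * (y powr (p - 1) * exp (L p * t)) \<le> mx.mix t f y + C * y powr (m - 1)"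
proof -
  interpret elasticity_limit f g q m K by fact
  obtain c C where c: "c > 0" "C \<ge> 0" and le: "\<And>z. z > 0 \<Longrightarrow> c * z powr (p - 1) \<le> f z + C * z powr (m - 1)"
    using lower_bound[OF p(1,2)] by blast
  obtain D where D: "\<And>t. t \<ge> 1 \<Longrightarrow> mx.moment t (m - 1) \<le> D"
    using moment_decay[OF m] by blast
  obtain d where d: "d > 0" "\<And>t. t \<ge> 1 \<Longrightarrow> d * exp (L p * t) \<le> mx.moment t (p - 1)"
    using moment_lower[OF p(3)] by blast
  have "(c * d) * (y powr (p - 1) * exp (L p * t)) \<le> mx.mix t f y + (C * \<bar>D\<bar>) * y powr (m - 1)"
    if t: "t \<ge> 1" and y: "y > 0" for t y
  proof -
    have "\<bar>mx.mix t (\<lambda>z. z powr (p - 1)) y\<bar> \<le> 1 / c * mx.mix t f y + C / c * (y powr (m - 1) * mx.moment t (m - 1))"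
    proof (rule mx.mix_bound[OF power_bounded_powr power_bounded_f y])
      fix z :: real assume "0 < z"
      then show "\<bar>z powr (p - 1)\<bar> \<le> 1 / c * f z + C / c * z powr (m - 1)"
        using le[of z] c by (simp add: field_simps)
    qed
    then have "c * (y powr (p - 1) * mx.moment t (p - 1)) \<le> mx.mix t f y + C * (y powr (m - 1) * mx.moment t (m - 1))"
      using c y mx.moment_nonneg[of t "p - 1"] by (simp add: mx.mix_powr field_simps)
    moreover have "c * (y powr (p - 1) * (d * exp (L p * t))) \<le> c * (y powr (p - 1) * mx.moment t (p - 1))"
      using d(2)[OF t] c by (intro mult_left_mono) auto
    moreover have "C * (y powr (m - 1) * mx.moment t (m - 1)) \<le> C * (y powr (m - 1) * \<bar>D\<bar>)"
      using D[OF t] c by (intro mult_left_mono) auto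
    ultimately show ?thesis by (simp add: ac_simps)
  qed
  then show ?thesis using c d by (intro exI[of _ "c * d"] conjI exI[of _ "C * \<bar>D\<bar>"]) auto
qed

lemma mix_comparison:
  assumes "elasticity_limit f g q m K" and m: "L m < 0" and "0 < \<epsilon>"
  shows "\<exists>C\<ge>0. \<forall>t\<ge>1. \<forall>y>0. \<bar>mx.mix t (\<lambda>z. g z - (1 - q) * f z) y\<bar> \<le> \<epsilon> * mx.mix t f y + C * y powr (m - 1)"
proof -
  interpret elasticity_limit f g q m K by fact
  obtain C where C: "C \<ge> 0" "\<And>z. z > 0 \<Longrightarrow> \<bar>g z - (1 - q) * f z\<bar> \<le> \<epsilon> * f z + C * z powr (m - 1)"
    using comparison[OF \<open>0 < \<epsilon>\<close>] by blast
  obtain D where D: "\<And>t. t \<ge> 1 \<Longrightarrow> mx.moment t (m - 1) \<le> D"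
    using moment_decay[OF m] by blast
  have "\<bar>mx.mix t (\<lambda>z. g z - (1 - q) * f z) y\<bar> \<le> \<epsilon> * mx.mix t f y + (C * \<bar>D\<bar>) * y powr (m - 1)"
    if t: "t \<ge> 1" and y: "y > 0" for t y
  proof -
    have "\<bar>mx.mix t (\<lambda>z. g z - (1 - q) * f z) y\<bar> \<le> \<epsilon> * mx.mix t f y + C * (y powr (m - 1) * mx.moment t (m - 1))"
      by (rule mx.mix_bound[OF power_bounded_diff power_bounded_f y C(2)])
    moreover have "C * (y powr (m - 1) * mx.moment t (m - 1)) \<le> C * (y powr (m - 1) * \<bar>D\<bar>)"
      using D[OF t] C(1) by (intro mult_left_mono) auto
    ultimately show ?thesis by (simp add: ac_simps)
  qed
  then show ?thesis using C(1) by (intro exI[of _ "C * \<bar>D\<bar>"]) auto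
qed

lemma mix_upper_growth:
  assumes "power_bounded h" and "0 \<le> C"
    and le: "\<And>z. 0 < z \<Longrightarrow> \<bar>h z\<bar> \<le> C * (z powr (p - 1) + z powr (m - 1))"
    and p: "0 < L p" and m: "L m < 0"
  shows "\<exists>C\<ge>0. \<forall>t\<ge>1. \<forall>y>0. \<bar>mx.mix t h y\<bar> \<le> C * (y powr (p - 1) * exp (L p * t) + y powr (m - 1))"
proof -
  obtain D where D: "\<And>t. t \<ge> 1 \<Longrightarrow> mx.moment t (m - 1) \<le> D"
    using moment_decay[OF m] by blast
  obtain d where d: "\<And>t. t \<ge> 1 \<Longrightarrow> mx.moment t (p - 1) \<le> d * exp (L p * t)"
    using moment_upper[OF p] by blast
  define B where "B = max \<bar>D\<bar> \<bar>d\<bar>"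
  have "\<bar>mx.mix t h y\<bar> \<le> (C * B) * (y powr (p - 1) * exp (L p * t) + y powr (m - 1))"
    if t: "t \<ge> 1" and y: "y > 0" for t y
  proof -
    have "\<bar>mx.mix t h y\<bar> \<le> C * mx.mix t (\<lambda>z. z powr (p - 1)) y + C * (y powr (m - 1) * mx.moment t (m - 1))"
      by (rule mx.mix_bound[OF assms(1) power_bounded_powr y]) (use le in \<open>simp add: distrib_left\<close>)
    also have "\<dots> = C * (y powr (p - 1) * mx.moment t (p - 1) + y powr (m - 1) * mx.moment t (m - 1))"
      using y by (simp add: mx.mix_powr distrib_left)
    also have "\<dots> \<le> C * (y powr (p - 1) * (B * exp (L p * t)) + y powr (m - 1) * B)"
    proof (intro mult_left_mono add_mono \<open>0 \<le> C\<close>)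
      show "mx.moment t (m - 1) \<le> B" using D[OF t] by (simp add: B_def)
      have "d * exp (L p * t) \<le> B * exp (L p * t)" by (intro mult_right_mono) (auto simp: B_def)
      then show "mx.moment t (p - 1) \<le> B * exp (L p * t)" using d[OF t] by linarith
    qed auto
    finally show ?thesis by (simp add: algebra_simps)
  qed
  moreover have "0 \<le> C * B" using \<open>0 \<le> C\<close> by (simp add: B_def)
  ultimately show ?thesis by blast
qed

lemma mix_growth:
  assumes "elasticity_limit f g q m K" and p: "p < q" "0 < L p" and m: "L m < 0"
  shows "\<exists>C\<ge>0. \<forall>t\<ge>1. \<forall>y>0. mx.mix t f y \<le> C * (y powr (p - 1) * exp (L p * t) + y powr (m - 1))"
    and "\<exists>C\<ge>0. \<forall>t\<ge>1. \<forall>y>0. \<bar>mx.mix t (\<lambda>z. g z - k * f z) y\<bar> \<le> C * (y powr (p - 1) * exp (L p * t) + y powr (m - 1))"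
proof -
  interpret elasticity_limit f g q m K by fact
  obtain C where C: "C \<ge> 0" "\<And>z. z > 0 \<Longrightarrow> f z \<le> C * (z powr (p - 1) + z powr (m - 1)) \<and>
      g z \<le> C * (z powr (p - 1) + z powr (m - 1))"
    using upper_bound[OF p(1)] by blast
  have "\<bar>f z\<bar> \<le> C * (z powr (p - 1) + z powr (m - 1))" if "0 < z" for z
    using C(2)[OF that] f_nonneg[OF that] by simp
  from mix_upper_growth[OF power_bounded_f C(1) this p(2) m]
  show "\<exists>C\<ge>0. \<forall>t\<ge>1. \<forall>y>0. mx.mix t f y \<le> C * (y powr (p - 1) * exp (L p * t) + y powr (m - 1))"
    by (meson abs_le_D1)
  have "\<bar>g z - k * f z\<bar> \<le> ((1 + \<bar>k\<bar>) * C) * (z powr (p - 1) + z powr (m - 1))" if z: "0 < z" for z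
  proof -
    define P where "P = z powr (p - 1) + z powr (m - 1)"
    have "\<bar>g z - k * f z\<bar> \<le> g z + \<bar>k\<bar> * f z"
      using f_nonneg[OF z] g_nonneg[OF z] abs_triangle_ineq4[of "g z" "k * f z"] by (simp add: abs_mult)
    also have "\<dots> \<le> C * P + \<bar>k\<bar> * (C * P)"
      using C(2)[OF z] by (intro add_mono mult_left_mono) (auto simp: P_def)
    finally show ?thesis by (simp add: P_def algebra_simps)
  qed
  moreover have "0 \<le> (1 + \<bar>k\<bar>) * C" using C(1) by simp
  ultimately show "\<exists>C\<ge>0. \<forall>t\<ge>1. \<forall>y>0. \<bar>mx.mix t (\<lambda>z. g z - k * f z) y\<bar> \<le>
      C * (y powr (p - 1) * exp (L p * t) + y powr (m - 1))"
    by (intro mix_upper_growth[OF power_bounded_diff _ _ p(2) m])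
qed

text \<open>Applied to each utility with \<open>q0 = min q1 q2\<close>. For \<open>q0 = q\<close>
  the error is a small multiple of a bounded mixture plus a negative power of \<open>y t\<close>;
  for \<open>q0 < q\<close> the growth bound and \<open>vanish\<close> make the mixture itself
  negligible.\<close>

lemma mix_error_tendsto_zero:
  assumes E: "elasticity_limit f g q m K" and m: "L m < 0" and q0: "q0 \<le> q" and qs: "q < qs"
    and L_pos: "\<And>p. p < qs \<Longrightarrow> 0 < L p"
    and y: "filterlim y at_top at_top"
    and bounded: "eventually (\<lambda>t. mx.mix t f (y t) \<le> x) at_top"
    and vanish: "\<And>p. q0 < p \<Longrightarrow> p < qs \<Longrightarrow> ((\<lambda>t. y t powr (p - 1) * exp (L p * t)) \<longlongrightarrow> 0) at_top"
  shows "((\<lambda>t. mx.mix t (\<lambda>z. g z - (1 - q0) * f z) (y t)) \<longlongrightarrow> 0) at_top"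
proof -
  interpret elasticity_limit f g q m K by fact
  have ev: "eventually (\<lambda>t. 1 \<le> t \<and> 0 < y t) at_top"
    using eventually_ge_at_top[of 1] filterlim_at_top_dense[THEN iffD1, OF y, rule_format, of 0]
    by eventually_elim simp
  have ym: "((\<lambda>t. C * y t powr (m - 1)) \<longlongrightarrow> 0) at_top" for C
    using tendsto_mult_right_zero[OF tendsto_neg_powr[OF _ y, of "m - 1"], of C] m_less by simp
  show ?thesis
  proof (cases "q0 = q")
    case True
    show ?thesis
    proof (rule tendstoI)
      fix e :: real assume e: "0 < e"
      \<comment> \<open>Chosen so that \<epsilon> times the bound \<open>x\<close> costs at most
        half of \<open>e\<close>, also for \<open>x = 0\<close>.\<close>
      define \<epsilon> where "\<epsilon> = e / (2 * (1 + \<bar>x\<bar>))"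
      have \<epsilon>: "0 < \<epsilon>" "\<epsilon> * x \<le> e / 2"
        using e by (auto simp: \<epsilon>_def field_simps) (smt (verit) mult_left_mono)
      obtain C where C: "\<And>t y. t \<ge> 1 \<Longrightarrow> y > 0 \<Longrightarrow>
          \<bar>mx.mix t (\<lambda>z. g z - (1 - q) * f z) y\<bar> \<le> \<epsilon> * mx.mix t f y + C * y powr (m - 1)"
        using mix_comparison[OF E m \<epsilon>(1)] by blast
      have "eventually (\<lambda>t. C * y t powr (m - 1) < e / 2) at_top"
        using ym e by (intro order_tendstoD(2)[where y = 0]) auto
      then show "eventually (\<lambda>t. dist (mx.mix t (\<lambda>z. g z - (1 - q0) * f z) (y t)) 0 < e) at_top"
        using bounded ev
      proof eventually_elim
        case (elim t)
        have "\<epsilon> * mx.mix t f (y t) \<le> \<epsilon> * x" using elim \<epsilon> by (intro mult_left_mono) auto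
        then show ?case using C[of t "y t"] elim \<epsilon>(2) unfolding dist_real_def diff_0_right True by linarith
      qed
    qed
  next
    case False
    \<comment> \<open>Below \<open>q\<close>, so that the growth bound applies, and above
      \<open>q0\<close>, so that \<open>vanish\<close> applies.\<close>
    define p where "p = (q0 + q) / 2"
    have p: "q0 < p" "p < q" "p < qs" using False q0 qs by (auto simp: p_def)
    obtain C where C: "\<And>t y. t \<ge> 1 \<Longrightarrow> y > 0 \<Longrightarrow> \<bar>mx.mix t (\<lambda>z. g z - (1 - q0) * f z) y\<bar> \<le>
        C * (y powr (p - 1) * exp (L p * t) + y powr (m - 1))"
      using mix_growth(2)[OF E p(2) L_pos[OF p(3)] m, of "1 - q0"] by blast
    have "((\<lambda>t. C * (y t powr (p - 1) * exp (L p * t)) + C * y t powr (m - 1)) \<longlongrightarrow> 0) at_top"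
      using tendsto_add[OF tendsto_mult_right_zero[OF vanish[OF p(1,3)], of C] ym[of C]] by simp
    then show ?thesis
    proof (rule Lim_null_comparison[rotated])
      show "eventually (\<lambda>t. norm (mx.mix t (\<lambda>z. g z - (1 - q0) * f z) (y t)) \<le>
          C * (y t powr (p - 1) * exp (L p * t)) + C * y t powr (m - 1)) at_top"
        using ev by eventually_elim (use C in \<open>auto simp: distrib_left\<close>)
    qed
  qed
qed

end

text \<open>
  The locale assumption on \<open>L\<close> is what convexity of \<open>L\<close> and \<open>L 1 < 0\<close> give. It says that
  \<open>L p / (1 - p)\<close>, the exponential growth rate of the solution \<open>y\<close> of \<open>y powr (p - 1) * exp (L p * t) = 1\<close>,
  is strictly decreasing in \<open>p\<close>, so the smaller exponent dominates.
\<close>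

locale dual_wealth =
  A: horizon_family MA wA uA L + B: horizon_family MB wB uB L +
  E1: elasticity_limit f1 g1 q1 m K + E2: elasticity_limit f2 g2 q2 m K
  for MA :: "'a measure" and wA uA and MB :: "'b measure" and wB uB and L f1 g1 q1 f2 g2 q2 m K +
  fixes qs :: real
  assumes L_m: "L m < 0" and L_pos: "\<And>p. p < qs \<Longrightarrow> 0 < L p"
    and q1_less: "q1 < qs" and q2_less: "q2 < qs" and qs_less: "qs \<le> m"
    and L_ratio: "\<And>p p'. p' < p \<Longrightarrow> p < 1 \<Longrightarrow> L p * (1 - p') < (1 - p) * L p'"
    and A_pos: "\<And>t y. 0 < t \<Longrightarrow> 0 < y \<Longrightarrow> 0 < A.mx.mix t g1 y"
begin

text \<open>This will be \<open>- v_y\<close>, and \<open>risky\<close> will be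
  \<open>y * v_yy\<close>.\<close>

definition wealth :: "real \<Rightarrow> real \<Rightarrow> real" where
  "wealth t y = A.mx.mix t f1 y + B.mx.mix t f2 y"

definition risky :: "real \<Rightarrow> real \<Rightarrow> real" where
  "risky t y = A.mx.mix t g1 y + B.mx.mix t g2 y"

lemma has_real_derivative_wealth:
  assumes "0 < y"
  shows "(wealth t has_real_derivative - risky t y / y) (at y)"
proof -
  have "((\<lambda>y. A.mx.mix t f1 y + B.mx.mix t f2 y) has_real_derivative
      - A.mx.mix t g1 y / y + - B.mx.mix t g2 y / y) (at y)"
    by (intro DERIV_add A.mx.has_real_derivative_mix B.mx.has_real_derivative_mix assms
        E1.power_bounded_f E1.power_bounded_g E2.power_bounded_f E2.power_bounded_g E1.deriv_f E2.deriv_f)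
  then show ?thesis
    by (simp add: wealth_def[abs_def] risky_def diff_divide_distrib)
qed

lemma risky_pos: "0 < t \<Longrightarrow> 0 < y \<Longrightarrow> 0 < risky t y"
  unfolding risky_def using A_pos B.mx.mix_nonneg[of g2 y t] E2.g_nonneg by (simp add: add_pos_nonneg)

lemma wealth_strict_decreasing:
  assumes "0 < t" "0 < y" "y < z"
  shows "wealth t z < wealth t y"
proof (rule DERIV_neg_imp_decreasing[OF assms(3)])
  fix x assume "y \<le> x" "x \<le> z"
  then have "0 < x" using assms by simp
  then show "\<exists>D. (wealth t has_real_derivative D) (at x) \<and> D < 0"
    using has_real_derivative_wealth[of x t] risky_pos[OF assms(1), of x] by auto
qed

text \<open>A utility whose exponent lies below \<open>p\<close> supplies the bound; the
  contribution of the other one is nonnegative.\<close>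

lemma wealth_lower_growth:
  assumes p: "min q1 q2 < p" "p < qs"
  shows "\<exists>c>0. \<exists>C\<ge>0. \<forall>t\<ge>1. \<forall>y>0. c * (y powr (p - 1) * exp (L p * t)) \<le> wealth t y + C * y powr (m - 1)"
proof (cases "q1 < p")
  case True
  have nn: "0 \<le> B.mx.mix t f2 y" if "y > 0" for t y using B.mx.mix_nonneg[of f2 y t] E2.f_nonneg that by simp
  obtain c C where "c > 0" "C \<ge> 0" and C: "\<And>t y. t \<ge> 1 \<Longrightarrow> y > 0 \<Longrightarrow>
      c * (y powr (p - 1) * exp (L p * t)) \<le> A.mx.mix t f1 y + C * y powr (m - 1)"
    using A.mix_lower_growth[OF E1.elasticity_limit_axioms True _ L_pos[OF p(2)] L_m] p qs_less by auto
  have "c * (y powr (p - 1) * exp (L p * t)) \<le> wealth t y + C * y powr (m - 1)" if "t \<ge> 1" "y > 0" for t y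
    using C[OF that] nn[of y t] that unfolding wealth_def by linarith
  then show ?thesis using \<open>c > 0\<close> \<open>C \<ge> 0\<close> by blast
next
  case False
  then have "q2 < p" using p by auto
  have nn: "0 \<le> A.mx.mix t f1 y" if "y > 0" for t y using A.mx.mix_nonneg[of f1 y t] E1.f_nonneg that by simp
  obtain c C where "c > 0" "C \<ge> 0" and C: "\<And>t y. t \<ge> 1 \<Longrightarrow> y > 0 \<Longrightarrow>
      c * (y powr (p - 1) * exp (L p * t)) \<le> B.mx.mix t f2 y + C * y powr (m - 1)"
    using B.mix_lower_growth[OF E2.elasticity_limit_axioms \<open>q2 < p\<close> _ L_pos[OF p(2)] L_m] p qs_less by auto
  have "c * (y powr (p - 1) * exp (L p * t)) \<le> wealth t y + C * y powr (m - 1)" if "t \<ge> 1" "y > 0" for t y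
    using C[OF that] nn[of y t] that unfolding wealth_def by linarith
  then show ?thesis using \<open>c > 0\<close> \<open>C \<ge> 0\<close> by blast
qed

text \<open>At a fixed dual level the wealth grows exponentially with the horizon, which forces the
  dual point beyond every level \<open>b\<close>.\<close>

lemma eventually_wealth_greater:
  assumes "0 < b"
  shows "eventually (\<lambda>t. x < wealth t b) at_top"
proof -
  define p where "p = (min q1 q2 + qs) / 2"
  have p: "min q1 q2 < p" "p < qs" using q1_less q2_less by (auto simp: p_def)
  obtain c C where c: "c > 0" and C: "\<And>t y. t \<ge> 1 \<Longrightarrow> y > 0 \<Longrightarrow>
      c * (y powr (p - 1) * exp (L p * t)) \<le> wealth t y + C * y powr (m - 1)"
    using wealth_lower_growth[OF p] by blast
  have "filterlim (\<lambda>t. exp (L p * t)) at_top at_top"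
    by (intro filterlim_compose[OF exp_at_top] filterlim_tendsto_pos_mult_at_top[OF tendsto_const] filterlim_ident L_pos p)
  then have "filterlim (\<lambda>t. (c * b powr (p - 1)) * exp (L p * t)) at_top at_top"
    using c assms by (intro filterlim_tendsto_pos_mult_at_top[OF tendsto_const]) auto
  then have "eventually (\<lambda>t. x + C * b powr (m - 1) < (c * b powr (p - 1)) * exp (L p * t)) at_top"
    by (simp add: filterlim_at_top_dense)
  then show ?thesis using eventually_ge_at_top[of 1]
    by eventually_elim (use C assms in \<open>fastforce simp: ac_simps\<close>)
qed

lemma wealth_tendsto_zero:
  assumes "1 \<le> t"
  shows "(wealth t \<longlongrightarrow> 0) at_top"
proof -
  \<comment> \<open>Any exponent below both \<open>q1\<close> and \<open>q2\<close> with positive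
    \<open>L p\<close> serves here, as the horizon is fixed.\<close>
  define p where "p = min q1 q2 - 1"
  have p: "p < q1" "p < q2" "0 < L p" using q1_less q2_less L_pos[of p] by (auto simp: p_def)
  have p1: "p < 1" using p E1.q_less E1.m_less by simp
  obtain C1 where C1: "\<And>y. y > 0 \<Longrightarrow> A.mx.mix t f1 y \<le> C1 * (y powr (p - 1) * exp (L p * t) + y powr (m - 1))"
    using A.mix_growth(1)[OF E1.elasticity_limit_axioms p(1,3) L_m] assms by blast
  obtain C2 where C2: "\<And>y. y > 0 \<Longrightarrow> B.mx.mix t f2 y \<le> C2 * (y powr (p - 1) * exp (L p * t) + y powr (m - 1))"
    using B.mix_growth(1)[OF E2.elasticity_limit_axioms p(2,3) L_m] assms by blast
  have "((\<lambda>y. (C1 + C2) * (y powr (p - 1) * exp (L p * t) + y powr (m - 1))) \<longlongrightarrow>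
      (C1 + C2) * (0 * exp (L p * t) + 0)) at_top"
    using p1 E1.m_less by (intro tendsto_intros tendsto_neg_powr filterlim_ident) auto
  then have lim: "((\<lambda>y. (C1 + C2) * (y powr (p - 1) * exp (L p * t) + y powr (m - 1))) \<longlongrightarrow> 0) at_top"
    by simp
  show ?thesis
  proof (rule tendsto_sandwich[OF _ _ tendsto_const lim])
    show "eventually (\<lambda>y. 0 \<le> wealth t y) at_top"
      using eventually_gt_at_top[of 0]
      by eventually_elim (use A.mx.mix_nonneg[of f1] B.mx.mix_nonneg[of f2] E1.f_nonneg E2.f_nonneg in \<open>simp add: wealth_def\<close>)
    show "eventually (\<lambda>y. wealth t y \<le> (C1 + C2) * (y powr (p - 1) * exp (L p * t) + y powr (m - 1))) at_top"
      using eventually_gt_at_top[of 0]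
    proof eventually_elim
      case (elim y)
      then show ?case using add_mono[OF C1[of y] C2[of y]] by (simp add: wealth_def distrib_right)
    qed
  qed
qed

section \<open>The dual point for long horizons\<close>

definition dual_point :: "real \<Rightarrow> real \<Rightarrow> real" where
  "dual_point x t = (THE y. 0 < y \<and> x = wealth t y)"

text \<open>For large \<open>t\<close> the wealth at \<open>b\<close> exceeds \<open>x\<close>, and
  it decays to 0 in \<open>y\<close>, so the intermediate value theorem gives a solution; strict
  monotonicity makes it unique and identifies the description operator.\<close>

lemma dual_point_eventually:
  assumes x: "0 < x" and b: "0 < b"
  shows "eventually (\<lambda>t. b < dual_point x t \<and> x = wealth t (dual_point x t)) at_top"
  using eventually_wealth_greater[OF b, of x] eventually_ge_at_top[of 1]
proof eventually_elim
  case (elim t)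
  have t: "0 < t" using elim by simp
  have "eventually (\<lambda>y. wealth t y < x) at_top"
    using wealth_tendsto_zero elim x by (intro order_tendstoD(2)) auto
  then have "eventually (\<lambda>y. wealth t y < x \<and> b \<le> y) at_top"
    using eventually_ge_at_top[of b] by eventually_elim simp
  then obtain d where d: "wealth t d < x" "b \<le> d"
    unfolding eventually_at_top_linorder by blast
  have "\<exists>y\<ge>b. y \<le> d \<and> wealth t y = x"
  proof (rule IVT2)
    show "\<forall>y. b \<le> y \<and> y \<le> d \<longrightarrow> isCont (wealth t) y"
      using b has_real_derivative_wealth by (meson DERIV_isCont less_le_trans)
  qed (use d elim in auto)
  then obtain y where y: "b \<le> y" "wealth t y = x" by blast
  have uniq: "z = y" if "0 < z \<and> x = wealth t z" for z
    using wealth_strict_decreasing[OF t, of y z] wealth_strict_decreasing[OF t, of z y] y b that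
    by (cases y z rule: linorder_cases) auto
  have "dual_point x t = y"
    unfolding dual_point_def by (rule the_equality) (use y b uniq in auto)
  moreover have "b \<noteq> y" using y elim by auto
  ultimately show ?case using y by auto
qed

lemma dual_point_at_top:
  assumes "0 < x"
  shows "filterlim (dual_point x) at_top at_top"
  unfolding filterlim_at_top_gt[where c = 0]
proof (intro allI impI)
  fix b :: real assume "0 < b"
  then show "eventually (\<lambda>t. b \<le> dual_point x t) at_top"
    by (rule eventually_mono[OF dual_point_eventually[OF assms]]) simp
qed

text \<open>For an exponent \<open>p'\<close> between \<open>min q1 q2\<close> and \<open>p\<close>,
  the lower growth bound at wealth \<open>x\<close> keeps
  \<open>y powr (p' - 1) * exp (L p' * t)\<close> bounded. Raising it to the power
  \<open>s = (1 - p) / (1 - p')\<close> produces \<open>y powr (p - 1) * exp (s * L p' * t)\<close>,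
  and \<open>L_ratio\<close> says that \<open>s * L p'\<close> exceeds \<open>L p\<close>, by
  \<gamma>.\<close>

lemma dual_point_power_vanishes:
  assumes x: "0 < x" and p: "min q1 q2 < p" "p < qs"
  shows "((\<lambda>t. dual_point x t powr (p - 1) * exp (L p * t)) \<longlongrightarrow> 0) at_top"
proof -
  define p' where "p' = (min q1 q2 + p) / 2"
  have p': "min q1 q2 < p'" "p' < p" "p' < qs" using p by (auto simp: p'_def)
  have p1: "p < 1" "p' < 1" using p p' qs_less E1.m_less by auto
  obtain c C where c: "c > 0" "C \<ge> 0" and C: "\<And>t y. t \<ge> 1 \<Longrightarrow> y > 0 \<Longrightarrow>
      c * (y powr (p' - 1) * exp (L p' * t)) \<le> wealth t y + C * y powr (m - 1)"
    using wealth_lower_growth[OF p'(1,3)] by blast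
  define s where "s = (1 - p) / (1 - p')"
  define \<gamma> where "\<gamma> = s * L p' - L p"
  have s: "0 < s" "(p' - 1) * s = p - 1" using p1 by (auto simp: s_def field_simps)
  have \<gamma>: "0 < \<gamma>" using L_ratio[OF p'(2) p1(1)] p1 by (simp add: \<gamma>_def s_def field_simps)
  have "((\<lambda>t. exp (- \<gamma> * t)) \<longlongrightarrow> 0) at_top"
    using \<gamma> by (intro filterlim_compose[OF exp_at_bot] filterlim_tendsto_neg_mult_at_bot[OF tendsto_const] filterlim_ident) auto
  then have lim: "((\<lambda>t. ((x + C) / c) powr s * exp (- \<gamma> * t)) \<longlongrightarrow> 0) at_top"
    by (rule tendsto_mult_right_zero)
  show ?thesis
  proof (rule tendsto_sandwich[OF _ _ tendsto_const lim])
    show "eventually (\<lambda>t. 0 \<le> dual_point x t powr (p - 1) * exp (L p * t)) at_top" by simp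
    show "eventually (\<lambda>t. dual_point x t powr (p - 1) * exp (L p * t) \<le> ((x + C) / c) powr s * exp (- \<gamma> * t)) at_top"
      using dual_point_eventually[OF x, of 1, simplified] eventually_ge_at_top[of 1]
    proof eventually_elim
      case (elim t)
      define y where "y = dual_point x t"
      define z where "z = y powr (p' - 1) * exp (L p' * t)"
      have y: "1 < y" "x = wealth t y" using elim by (auto simp: y_def)
      \<comment> \<open>As \<open>y > 1\<close> and \<open>m < 1\<close>, the correction term is at
        most \<open>C\<close>.\<close>
      have "y powr (m - 1) \<le> y powr 0" using y E1.m_less by (intro powr_mono) auto
      then have "C * y powr (m - 1) \<le> C" using c y mult_left_mono[of "y powr (m - 1)" 1 C] by simp
      then have "c * z \<le> x + C" using C[of t y] elim y unfolding z_def by simp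
      then have "z \<le> (x + C) / c" using c by (simp add: field_simps)
      then have le: "z powr s \<le> ((x + C) / c) powr s"
        using s by (intro powr_mono2) (auto simp: z_def)
      have "z powr s = y powr (p - 1) * exp (s * (L p' * t))"
        unfolding z_def by (simp add: powr_mult powr_powr s(2)) (simp add: powr_def)
      then have "y powr (p - 1) * exp (L p * t) = z powr s * exp (- \<gamma> * t)"
        by (simp add: \<gamma>_def algebra_simps flip: exp_add)
      also have "\<dots> \<le> ((x + C) / c) powr s * exp (- \<gamma> * t)"
        using le by (intro mult_right_mono) auto
      finally show ?case by (simp add: y_def)
    qed
  qed
qed

theorem risky_tendsto:
  assumes x: "0 < x"
  shows "((\<lambda>t. risky t (dual_point x t)) \<longlongrightarrow> (1 - min q1 q2) * x) at_top"
proof -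
  let ?q = "min q1 q2" and ?y = "dual_point x"
  have sol: "eventually (\<lambda>t. 0 < ?y t \<and> x = wealth t (?y t)) at_top"
    using dual_point_eventually[OF x, of 1, simplified] by eventually_elim simp
  have le1: "eventually (\<lambda>t. A.mx.mix t f1 (?y t) \<le> x) at_top"
    using sol
  proof eventually_elim
    case (elim t)
    then show ?case using B.mx.mix_nonneg[of f2 "?y t" t] E2.f_nonneg unfolding wealth_def by simp
  qed
  have le2: "eventually (\<lambda>t. B.mx.mix t f2 (?y t) \<le> x) at_top"
    using sol
  proof eventually_elim
    case (elim t)
    then show ?case using A.mx.mix_nonneg[of f1 "?y t" t] E1.f_nonneg unfolding wealth_def by simp
  qed
  have e1: "((\<lambda>t. A.mx.mix t (\<lambda>z. g1 z - (1 - ?q) * f1 z) (?y t)) \<longlongrightarrow> 0) at_top"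
    by (rule A.mix_error_tendsto_zero[OF E1.elasticity_limit_axioms L_m _ q1_less L_pos dual_point_at_top[OF x]
          le1 dual_point_power_vanishes[OF x]]) auto
  have e2: "((\<lambda>t. B.mx.mix t (\<lambda>z. g2 z - (1 - ?q) * f2 z) (?y t)) \<longlongrightarrow> 0) at_top"
    by (rule B.mix_error_tendsto_zero[OF E2.elasticity_limit_axioms L_m _ q2_less L_pos dual_point_at_top[OF x]
          le2 dual_point_power_vanishes[OF x]]) auto
  have "((\<lambda>t. (1 - ?q) * x + (A.mx.mix t (\<lambda>z. g1 z - (1 - ?q) * f1 z) (?y t) +
      B.mx.mix t (\<lambda>z. g2 z - (1 - ?q) * f2 z) (?y t))) \<longlongrightarrow> (1 - ?q) * x + (0 + 0)) at_top"
    by (intro tendsto_intros e1 e2)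
  then have lim: "((\<lambda>t. (1 - ?q) * x + (A.mx.mix t (\<lambda>z. g1 z - (1 - ?q) * f1 z) (?y t) +
      B.mx.mix t (\<lambda>z. g2 z - (1 - ?q) * f2 z) (?y t))) \<longlongrightarrow> (1 - ?q) * x) at_top"
    by (simp only: add_0_right)
  show ?thesis
  proof (rule Lim_transform_eventually[OF lim])
    show "eventually (\<lambda>t. (1 - ?q) * x + (A.mx.mix t (\<lambda>z. g1 z - (1 - ?q) * f1 z) (?y t) +
      B.mx.mix t (\<lambda>z. g2 z - (1 - ?q) * f2 z) (?y t)) = risky t (?y t)) at_top"
      using sol
    proof eventually_elim
      case (elim t)
      then have y: "0 < ?y t" and xe: "x = wealth t (?y t)" by auto
      have "(1 - ?q) * x = (1 - ?q) * A.mx.mix t f1 (?y t) + (1 - ?q) * B.mx.mix t f2 (?y t)"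
        by (subst xe) (simp only: wealth_def distrib_left)
      then show ?case
        by (simp only: A.mx.mix_diff_scaled[OF E1.power_bounded_f E1.power_bounded_g y]
          B.mx.mix_diff_scaled[OF E2.power_bounded_f E2.power_bounded_g y] risky_def)
    qed
  qed
qed

end

section \<open>Moment growth of the two kernels and the concrete model\<close>

context lognormal_kernel
begin

lemma spot_horizon_family: "horizon_family lborel weight scaling (\<lambda>p. rate (p - 1))"
proof
  fix p :: real
  show "\<exists>D. \<forall>t\<ge>1. spot.moment t (p - 1) \<le> D" if "rate (p - 1) < 0"
    using that by (intro exI[of _ 1]) (auto simp: spot_moment mult_nonpos_nonneg)
  show "\<exists>D. \<forall>t\<ge>1. spot.moment t (p - 1) \<le> D * exp (rate (p - 1) * t)" if "0 < rate (p - 1)"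
    by (intro exI[of _ 1]) (auto simp: spot_moment)
  show "\<exists>d>0. \<forall>t\<ge>1. d * exp (rate (p - 1) * t) \<le> spot.moment t (p - 1)" if "0 < rate (p - 1)"
    by (intro exI[of _ 1]) (auto simp: spot_moment)
qed

lemma run_horizon_family:
  "horizon_family (lborel \<Otimes>\<^sub>M lborel) run_weight (\<lambda>_. run_scaling) (\<lambda>p. rate (p - 1))"
proof
  fix p :: real
  show "\<exists>D. \<forall>t\<ge>1. run.moment t (p - 1) \<le> D" if neg: "rate (p - 1) < 0"
  proof (intro exI[of _ "- 1 / rate (p - 1)"] allI impI)
    fix t :: real assume "1 \<le> t"
    then show "run.moment t (p - 1) \<le> - 1 / rate (p - 1)"
      using neg by (simp add: run_moment diff_divide_distrib divide_le_0_iff)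
  qed
  show "\<exists>D. \<forall>t\<ge>1. run.moment t (p - 1) \<le> D * exp (rate (p - 1) * t)" if pos: "0 < rate (p - 1)"
  proof (intro exI[of _ "1 / rate (p - 1)"] allI impI)
    fix t :: real assume "1 \<le> t"
    then show "run.moment t (p - 1) \<le> 1 / rate (p - 1) * exp (rate (p - 1) * t)"
      using pos by (simp add: run_moment divide_right_mono)
  qed
  show "\<exists>d>0. \<forall>t\<ge>1. d * exp (rate (p - 1) * t) \<le> run.moment t (p - 1)" if pos: "0 < rate (p - 1)"
  \<comment> \<open>The factor \<open>1 - exp (- rate (p - 1) * t)\<close> in the moment increases
    with \<open>t\<close>; its value at \<open>t = 1\<close> gives the constant.\<close>
  proof (intro exI[of _ "(1 - exp (- rate (p - 1))) / rate (p - 1)"] conjI allI impI)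
    show "0 < (1 - exp (- rate (p - 1))) / rate (p - 1)" using pos by simp
    fix t :: real assume t: "1 \<le> t"
    have "exp (rate (p - 1) * (t - 1)) \<ge> 1" using pos t by simp
    then have "(1 - exp (- rate (p - 1))) * exp (rate (p - 1) * t) \<le> exp (rate (p - 1) * t) - 1"
      by (simp add: algebra_simps flip: exp_add)
    then show "(1 - exp (- rate (p - 1))) / rate (p - 1) * exp (rate (p - 1) * t) \<le> run.moment t (p - 1)"
      using pos t by (simp add: run_moment divide_right_mono)
  qed
qed

end

theorem theorem2p7:
  fixes r \<delta> \<mu> \<sigma> \<theta> q1 q2 qbar K :: real and U1 U2 :: "real \<Rightarrow> real"
  assumes "0 < r" "0 < \<delta>" "0 < \<mu>" "0 < \<sigma>"
    and "\<theta> = sharpe r \<mu> \<sigma>" "\<theta> \<noteq> 0"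
    and "utility U1" "utility U2"
    and "q1 < qstar r \<delta> \<theta>" "q2 < qstar r \<delta> \<theta>"
    and "C2_on {0<..} (dual U1)" "C2_on {0<..} (dual U2)"
    and "(rel_risk (dual U1) \<longlongrightarrow> 1 - q1) (at_right 0)"
    and "(rel_risk (dual U2) \<longlongrightarrow> 1 - q2) (at_right 0)"
    and "Max {q1, q2, 0} < qbar" "qbar < 1" "0 < K"
    and "\<And>y. 1 \<le> y \<Longrightarrow> y * deriv (deriv (dual U1)) y \<le> K * y powr (qbar - 1)"
    and "\<And>y. 1 \<le> y \<Longrightarrow> y * deriv (deriv (dual U2)) y \<le> K * y powr (qbar - 1)"
  shows "\<forall>x>0. ((\<lambda>t. opt_amount r \<delta> \<mu> \<sigma> U1 U2 x t) \<longlongrightarrow> \<theta> / \<sigma> * (1 - min q1 q2) * x) at_top"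
proof -
  define \<alpha> where "\<alpha> = alpha r \<delta> \<theta>"
  define a where "a = acoef \<theta>"
  define \<beta> where "\<beta> = beta r \<delta> \<theta>"
  define f1 where "f1 = (\<lambda>z. - deriv (dual U1) z)"
  define f2 where "f2 = (\<lambda>z. - deriv (dual U2) z)"
  define g1 where "g1 = (\<lambda>z. z * deriv (deriv (dual U1)) z)"
  define g2 where "g2 = (\<lambda>z. z * deriv (deriv (dual U2)) z)"
  have qbar: "q1 < qbar" "q2 < qbar" "0 < qbar" using assms(15) by auto
  have a2: "a\<^sup>2 = \<theta>\<^sup>2 / 2" by (simp add: a_def acoef_def power_divide)
  have a0: "a \<noteq> 0" using assms(6) by (simp add: a_def acoef_def)
  interpret Ker: lognormal_kernel a "\<alpha> - 1" \<beta> .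
  define L where "L = (\<lambda>p. Ker.rate (p - 1))"
  have \<theta>\<alpha>: "\<theta>\<^sup>2 * \<alpha> = \<theta>\<^sup>2 / 2 + r - \<delta>"
    using assms(6) by (simp add: \<alpha>_def alpha_def field_simps)
  \<comment> \<open>Vertex form, showing that q* is the smaller root of \<open>L\<close>.\<close>
  have L_sq: "L p = \<theta>\<^sup>2 / 2 * ((p - \<alpha>)\<^sup>2 - \<alpha>\<^sup>2) - \<delta>" for p
    unfolding L_def Ker.rate_def by (simp add: \<beta>_def beta_def a2 algebra_simps flip: a_def \<alpha>_def)
  \<comment> \<open>This form shows \<open>L 0 = - \<delta>\<close> and \<open>L 1 = - r\<close>,
    and that no term is positive between 0 and 1.\<close>
  have L_eq: "L p = \<theta>\<^sup>2 / 2 * (p * (p - 1)) - r * p - \<delta> * (1 - p)" for p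
  proof -
    have "L p = \<theta>\<^sup>2 / 2 * p\<^sup>2 - (\<theta>\<^sup>2 * \<alpha>) * p - \<delta>"
      unfolding L_sq by (simp add: power2_eq_square field_simps)
    then show ?thesis unfolding \<theta>\<alpha> by (simp add: power2_eq_square field_simps)
  qed
  have qstar_neg: "qstar r \<delta> \<theta> < 0"
  proof -
    have "\<bar>\<alpha>\<bar> < sqrt (\<alpha>\<^sup>2 + 2 * \<delta> / \<theta>\<^sup>2)"
      using assms(2,6) by (intro real_less_rsqrt) simp
    then show ?thesis unfolding qstar_def \<alpha>_def[symmetric] by linarith
  qed
  interpret E1: elasticity_limit f1 g1 q1 qbar K
    unfolding f1_def g1_def by (rule dual_elasticity_limit) (use assms qbar in auto)
  interpret E2: elasticity_limit f2 g2 q2 qbar K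
    unfolding f2_def g2_def by (rule dual_elasticity_limit) (use assms qbar in auto)
  interpret A: horizon_family lborel Ker.weight Ker.scaling L
    unfolding L_def by (rule Ker.spot_horizon_family)
  interpret B: horizon_family "lborel \<Otimes>\<^sub>M lborel" Ker.run_weight "\<lambda>_. Ker.run_scaling" L
    unfolding L_def by (rule Ker.run_horizon_family)
  interpret W: dual_wealth lborel Ker.weight Ker.scaling "lborel \<Otimes>\<^sub>M lborel" Ker.run_weight "\<lambda>_. Ker.run_scaling"
    L f1 g1 q1 f2 g2 q2 qbar K "qstar r \<delta> \<theta>"
  proof
    have "\<theta>\<^sup>2 / 2 * (qbar * (qbar - 1)) \<le> 0" using qbar assms(16) by (intro mult_nonneg_nonpos) auto
    moreover have "0 < r * qbar" "0 < \<delta> * (1 - qbar)" using qbar assms(1,2,16) by auto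
    ultimately show "L qbar < 0" unfolding L_eq by linarith
    show "0 < L p" if p: "p < qstar r \<delta> \<theta>" for p
    proof -
      have "sqrt (\<alpha>\<^sup>2 + 2 * \<delta> / \<theta>\<^sup>2) < \<alpha> - p"
        using p unfolding qstar_def \<alpha>_def[symmetric] by linarith
      then have "(sqrt (\<alpha>\<^sup>2 + 2 * \<delta> / \<theta>\<^sup>2))\<^sup>2 < (\<alpha> - p)\<^sup>2"
        by (intro power_strict_mono) (use assms(2) in auto)
      then have "\<alpha>\<^sup>2 + 2 * \<delta> / \<theta>\<^sup>2 < (p - \<alpha>)\<^sup>2"
        using assms(2) by (simp add: power2_commute)
      then have "\<theta>\<^sup>2 / 2 * (2 * \<delta> / \<theta>\<^sup>2) < \<theta>\<^sup>2 / 2 * ((p - \<alpha>)\<^sup>2 - \<alpha>\<^sup>2)"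
        using assms(6) by (intro mult_strict_left_mono) auto
      then show ?thesis unfolding L_sq using assms(6) by simp
    qed
    show "L p * (1 - p') < (1 - p) * L p'" if "p' < p" "p < 1" for p p'
    proof -
      \<comment> \<open>In the cross-multiplied difference the \<delta>-terms cancel and
        \<open>p - p'\<close> factors out.\<close>
      have "0 < (p - p') * (\<theta>\<^sup>2 / 2 * ((1 - p) * (1 - p')) + r)"
        using that assms(1) by (intro mult_pos_pos add_nonneg_pos) auto
      also have "\<dots> = (1 - p) * L p' - L p * (1 - p')"
        unfolding L_eq by (simp add: field_simps)
      finally show ?thesis by simp
    qed
    show "0 < Ker.spot.mix t g1 y" if "0 < t" "0 < y" for t y
    proof -
      obtain z0 where z0: "z0 > 0" "\<And>z. 0 < z \<Longrightarrow> z \<le> z0 \<Longrightarrow> 0 < g1 z"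
        using E1.near_zero[of 1] by auto
      show ?thesis
        by (rule Ker.spot_mix_pos[of g1 z0]) (use E1.power_bounded_g E1.g_nonneg z0 a0 that in auto)
    qed
  qed (use assms qstar_neg qbar in auto)
  \<comment> \<open>The absolute value in \<open>I_term\<close> is resolved by the sign of
    \<open>V'\<close>.\<close>
  have I_spot: "I_term r \<delta> \<theta> V y t = Ker.spot.mix t (\<lambda>z. - deriv V z) y"
    if nonneg: "\<And>z. 0 < z \<Longrightarrow> 0 \<le> - deriv V z" and y: "0 < y" for V y t
  proof -
    have "\<bar>deriv V (y * exp (a * sqrt t * \<eta>))\<bar> = - deriv V (y * exp (a * sqrt t * \<eta>))" for \<eta>
      using nonneg[of "y * exp (a * sqrt t * \<eta>)"] y by simp
    then show ?thesis
      unfolding I_term_def Ker.spot.mix_def Ker.weight_def Ker.scaling_def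
        \<alpha>_def[symmetric] a_def[symmetric] \<beta>_def[symmetric] mult.assoc[of "exp _ / _" "exp _"]
        integral_mult_right_zero by simp
  qed
  have v_y_eq: "v_y r \<delta> \<theta> U1 U2 y t = - W.wealth t y" if y: "0 < y" for y t
  proof -
    have "I_term r \<delta> \<theta> (dual U1) y t = Ker.spot.mix t f1 y"
      unfolding f1_def by (rule I_spot[OF _ y]) (use E1.f_nonneg in \<open>simp add: f1_def\<close>)
    moreover have "I_term r \<delta> \<theta> (dual U2) y \<tau> = Ker.spot.mix \<tau> f2 y" for \<tau>
      unfolding f2_def by (rule I_spot[OF _ y]) (use E2.f_nonneg in \<open>simp add: f2_def\<close>)
    ultimately show ?thesis
      unfolding v_y_def W.wealth_def Ker.run_mix[OF E2.power_bounded_f y]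
      by (simp add: set_lebesgue_integral_def)
  qed
  have v_yy_eq: "v_yy r \<delta> \<theta> U1 U2 y t = W.risky t y / y" if y: "0 < y" for y t
  proof -
    have "((\<lambda>z. - W.wealth t z) has_real_derivative W.risky t y / y) (at y)"
      using DERIV_minus[OF W.has_real_derivative_wealth[OF y, of t]] by simp
    \<comment> \<open>The identity for \<open>v_y\<close> holds for positive arguments only; an open
      half-line suffices to transfer the derivative.\<close>
    then have "((\<lambda>z. v_y r \<delta> \<theta> U1 U2 z t) has_real_derivative W.risky t y / y) (at y)"
      by (rule has_field_derivative_transform_within_open[of _ _ _ "{0<..}"]) (use y v_y_eq in auto)
    then show ?thesis unfolding v_yy_def by (rule DERIV_imp_deriv)
  qed
  \<comment> \<open>The two defining predicates coincide, so the descriptions agree for every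
    \<open>x\<close> and \<open>t\<close>, whether or not a solution exists.\<close>
  have y_of_eq: "y_of r \<delta> \<theta> U1 U2 x t = W.dual_point x t" for x t
    unfolding y_of_def W.dual_point_def by (rule arg_cong[where f = The]) (auto simp: v_y_eq)
  show ?thesis
  proof (intro allI impI)
    fix x :: real assume x: "0 < x"
    have "((\<lambda>t. \<theta> / \<sigma> * W.risky t (W.dual_point x t)) \<longlongrightarrow> \<theta> / \<sigma> * ((1 - min q1 q2) * x)) at_top"
      by (intro tendsto_intros W.risky_tendsto x)
    then have lim: "((\<lambda>t. \<theta> / \<sigma> * W.risky t (W.dual_point x t)) \<longlongrightarrow> \<theta> / \<sigma> * (1 - min q1 q2) * x) at_top"
      by (simp only: mult.assoc)
    have "eventually (\<lambda>t. \<theta> / \<sigma> * W.risky t (W.dual_point x t) = opt_amount r \<delta> \<mu> \<sigma> U1 U2 x t) at_top"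
      using W.dual_point_eventually[OF x, of 1, simplified]
    proof eventually_elim
      case (elim t)
      then have "0 < W.dual_point x t" by simp
      then show ?case
        unfolding opt_amount_def Let_def assms(5)[symmetric] y_of_eq by (simp add: v_yy_eq)
    qed
    then show "((\<lambda>t. opt_amount r \<delta> \<mu> \<sigma> U1 U2 x t) \<longlongrightarrow> \<theta> / \<sigma> * (1 - min q1 q2) * x) at_top"
      by (rule Lim_transform_eventually[OF lim])
  qed
qed

end
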